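(* Let $n\in\mathbb N$, let $r\in(0,+\infty]$, and let $\mathbb C^\times=\mathbb C\setminus\{0\}$. (i) There exists a Fréchet algebra bundle $(D,p)$ over $\mathbb C^\times$ such that for each $q\in\mathbb C^\times$ the fiber satisfies $D_q\cong\mathcal O_q(\mathbb D^n_r)$ (topological isomorphism of Fréchet algebras). (ii) There exists a Fréchet algebra bundle $(B,p)$ over $\mathbb C^\times$ such that for each $q\in\mathbb C^\times$ the fiber satisfies $B_q\cong\mathcal O_q(\mathbb B^n_r)$ (topological isomorphism of Fréchet algebras).
   Context: All algebras are complex, associative and unital. A Fréchet algebra is a complete metrizable locally convex algebra. $\mathbb Z_+=\{0,1,2,\dots\}$. Bundles. Let $X$ be a locally compact Hausdorff space. A family of vector spaces over $X$ is a pair $(E,p)$ where $E$ is a set and $p\colon E\to X$ is a surjective map, together with a complex vector space structure on each fiber $E_x=p^{-1}(x)$. Put $E\times_XE=\{(u,v)\in E\times E: p(u)=p(v)\}$. A prebundle of topological vector spaces over $X$ is a family $(E,p)$ of vector spaces over $X$ with a topology on $E$ such that $p$ is continuous and open, the zero section $0\colon X\to E$ is continuous, and the operations $E\times_XE\to E$, $(u,v)\mapsto u+v$, and $\mathbb C\times E\to E$, $(\lambda,u)\mapsto\lambda u$, are continuous. A function $\|\cdot\|\colon E\to[0,+\infty)$ is a seminorm if its restriction to each fiber is a seminorm. A family $\mathcal N=\{\|\cdot\|_\lambda:\lambda\in\Lambda\}$ of seminorms on $E$ is directed if for all $\lambda,\mu\in\Lambda$ there are $C>0$ and $\nu\in\Lambda$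 with $\|\cdot\|_\lambda\le C\|\cdot\|_\nu$ and $\|\cdot\|_\mu\le C\|\cdot\|_\nu$. For directed families, $\mathcal N\prec\mathcal N'$ if for each $\|\cdot\|_\lambda\in\mathcal N$ there are $C>0$ and $\|\cdot\|_\mu\in\mathcal N'$ with $\|\cdot\|_\lambda\le C\|\cdot\|_\mu$; they are equivalent if $\mathcal N\prec\mathcal N'$ and $\mathcal N'\prec\mathcal N$. A directed family $\mathcal N$ of seminorms on a prebundle $(E,p)$ is admissible if for each $x\in X$ the sets $\{u\in E: p(u)\in U,\ \|u\|_\lambda<\varepsilon\}$ ($\lambda\in\Lambda$, $\varepsilon>0$, $U\subseteq X$ an open neighborhood of $x$) form a base of open neighborhoods (in $E$) of $0\in E_x$. A locally convex uniform structure on $(E,p)$ is an equivalence class of admissible directed families of seminorms on $E$. A locally convex bundle over $X$ is a prebundle of topological vector spaces over $X$ together with a locally convex uniform structure. A locally convex algebra bundle over $X$ is a locally convex bundle $(E,p)$ together with an algebra structure on each fiber $E_x$ such that the map $E\times_XE\to E$, $(u,v)\mapsto uv$, is continuous. A Fréchet algebra bundle over $X$ is a locally convex algebra bundle over $X$ such that each fiber $E_x$ is a Fréchet algebra. Algebras. For $k\in\mathbb Z_+^n$ put $|k|=k_1+\cdots+k_n$, $x^k=x_1^{k_1}\cdots x_n^{k_n}$. For $q\in\mathbb C^\times$ let $w_q(k)=1$ if $|q|\ge1$ and $w_q(k)=|q|^{\sum_{i<j}k_ik_j}$ if $|q|<1$. For $t>0$ and $m\in\mathbb N$ let $[m]_t=1+t+\cdots+t^{m-1}$,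 $[m]_t!=[1]_t\cdots[m]_t$, $[0]_t!=1$, $[k]_t!=[k_1]_t!\cdots[k_n]_t!$. Then $\mathcal O_q(\mathbb D^n_r)$ is the set of formal series $a=\sum_{k\in\mathbb Z_+^n}c_kx^k$ ($c_k\in\mathbb C$) such that $\|a\|_\rho=\sum_k|c_k|w_q(k)\rho^{|k|}<\infty$ for all $\rho\in(0,r)$, and $\mathcal O_q(\mathbb B^n_r)$ is the set of formal series such that $\|a\|_\rho=\sum_k|c_k|\bigl([k]_{|q|^{-2}}!/[\,|k|\,]_{|q|^{-2}}!\bigr)^{1/2}\rho^{|k|}<\infty$ for all $\rho\in(0,r)$. Each is topologized by its own norms $\|\cdot\|_\rho$ ($0<\rho<r$) and is a Fréchet algebra under the continuous multiplication uniquely determined by $x_ix_j=q\,x_jx_i$ for $i<j$. *)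

theory Defs
  imports "HOL-Analysis.Analysis" "HOL-Algebra.Module"
begin

section \<open>Topological algebras on a carrier set\<close>

text \<open>\<open>Module.module\<close> takes its scalars from a ring record; this is the field of complex numbers.\<close>

definition C_ring :: "complex ring" where
  "C_ring = \<lparr>carrier = UNIV, monoid.mult = (*), one = 1, ring.zero = 0, add = (+)\<rparr>"

record 'a topalg = "(complex, 'a) module" + topol :: "'a topology"

text \<open>The locale \<open>Module.algebra\<close> is not used, because it makes the multiplication commutative.\<close>

definition complex_algebra :: "(complex, 'a, 'm) module_scheme \<Rightarrow> bool" where
  "complex_algebra A \<longleftrightarrow> Module.module C_ring A \<and> Ring.ring A \<and>
     (\<forall>c. \<forall>x\<in>carrier A. \<forall>y\<in>carrier A.
        (c \<odot>\<^bsub>A\<^esub> x) \<otimes>\<^bsub>A\<^esub> y = c \<odot>\<^bsub>A\<^esub> (x \<otimes>\<^bsub>A\<^esub> y) \<and>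
        x \<otimes>\<^bsub>A\<^esub> (c \<odot>\<^bsub>A\<^esub> y) = c \<odot>\<^bsub>A\<^esub> (x \<otimes>\<^bsub>A\<^esub> y))"

definition topological_vector_space :: "'a topalg \<Rightarrow> bool" where
  "topological_vector_space A \<longleftrightarrow> Module.module C_ring A \<and> topspace (topol A) = carrier A \<and>
     continuous_map (prod_topology (topol A) (topol A)) (topol A) (\<lambda>(x, y). x \<oplus>\<^bsub>A\<^esub> y) \<and>
     continuous_map (prod_topology euclidean (topol A)) (topol A) (\<lambda>(c, x). c \<odot>\<^bsub>A\<^esub> x)"

definition convex_in :: "'a topalg \<Rightarrow> 'a set \<Rightarrow> bool" where
  "convex_in A V \<longleftrightarrow> V \<subseteq> carrier A \<and>
     (\<forall>x\<in>V. \<forall>y\<in>V. \<forall>t\<in>{0..1}.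
        complex_of_real (1 - t) \<odot>\<^bsub>A\<^esub> x \<oplus>\<^bsub>A\<^esub> complex_of_real t \<odot>\<^bsub>A\<^esub> y \<in> V)"

definition locally_convex_space :: "'a topalg \<Rightarrow> bool" where
  "locally_convex_space A \<longleftrightarrow> topological_vector_space A \<and>
     (\<forall>U. openin (topol A) U \<and> \<zero>\<^bsub>A\<^esub> \<in> U \<longrightarrow>
        (\<exists>V. openin (topol A) V \<and> convex_in A V \<and> \<zero>\<^bsub>A\<^esub> \<in> V \<and> V \<subseteq> U))"

definition locally_convex_algebra :: "'a topalg \<Rightarrow> bool" where
  "locally_convex_algebra A \<longleftrightarrow> locally_convex_space A \<and> complex_algebra A \<and>
     continuous_map (prod_topology (topol A) (topol A)) (topol A) (\<lambda>(x, y). x \<otimes>\<^bsub>A\<^esub> y)"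

text \<open>Cauchy filters with respect to the translation-invariant uniformity.\<close>

definition cauchy_filter_in :: "'a topalg \<Rightarrow> 'a filter \<Rightarrow> bool" where
  "cauchy_filter_in A F \<longleftrightarrow> eventually (\<lambda>x. x \<in> carrier A) F \<and>
     (\<forall>U. openin (topol A) U \<and> \<zero>\<^bsub>A\<^esub> \<in> U \<longrightarrow>
        (\<exists>S\<subseteq>carrier A. eventually (\<lambda>x. x \<in> S) F \<and> (\<forall>x\<in>S. \<forall>y\<in>S. x \<ominus>\<^bsub>A\<^esub> y \<in> U)))"

definition complete_tvs :: "'a topalg \<Rightarrow> bool" where
  "complete_tvs A \<longleftrightarrow>
     (\<forall>F. F \<noteq> bot \<and> cauchy_filter_in A F \<longrightarrow> (\<exists>l. limitin (topol A) (\<lambda>x. x) l F))"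

definition frechet_algebra :: "'a topalg \<Rightarrow> bool" where
  "frechet_algebra A \<longleftrightarrow>
     locally_convex_algebra A \<and> metrizable_space (topol A) \<and> complete_tvs A"

definition topalg_iso :: "'a topalg \<Rightarrow> 'b topalg \<Rightarrow> bool" where
  "topalg_iso A B \<longleftrightarrow> (\<exists>f. f \<in> ring_hom A B \<and>
     (\<forall>c. \<forall>x\<in>carrier A. f (c \<odot>\<^bsub>A\<^esub> x) = c \<odot>\<^bsub>B\<^esub> f x) \<and>
     homeomorphic_map (topol A) (topol B) f)"

section \<open>Bundles\<close>

text \<open>
  The set $E$ is the underlying set of \<open>total\<close>.  The operations are meant on pairs of points in
  the same fiber; their other values, like the values of seminorms outside $E$, play no role.
  The notions that concern only the vector space structure ignore \<open>bmult\<close> and \<open>bone\<close>.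
\<close>

record ('e, 'x) bundle_data =
  total :: "'e topology"
  proj :: "'e \<Rightarrow> 'x"
  badd :: "'e \<Rightarrow> 'e \<Rightarrow> 'e"
  bzero :: "'x \<Rightarrow> 'e"
  bscale :: "complex \<Rightarrow> 'e \<Rightarrow> 'e"
  bmult :: "'e \<Rightarrow> 'e \<Rightarrow> 'e"
  bone :: "'x \<Rightarrow> 'e"
  unif :: "('e \<Rightarrow> real) set set"

definition fiber_set :: "('e, 'x) bundle_data \<Rightarrow> 'x \<Rightarrow> 'e set" where
  "fiber_set E x = {u \<in> topspace (total E). proj E u = x}"

definition fiber :: "('e, 'x) bundle_data \<Rightarrow> 'x \<Rightarrow> 'e topalg" where
  "fiber E x = \<lparr>carrier = fiber_set E x, monoid.mult = bmult E, one = bone E x,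
     ring.zero = bzero E x, add = badd E, smult = bscale E,
     topol = subtopology (total E) (fiber_set E x)\<rparr>"

definition fiber_product :: "('e, 'x) bundle_data \<Rightarrow> ('e \<times> 'e) topology" where
  "fiber_product E =
     subtopology (prod_topology (total E) (total E)) {(u, v). proj E u = proj E v}"

definition prebundle :: "'x topology \<Rightarrow> ('e, 'x) bundle_data \<Rightarrow> bool" where
  "prebundle X E \<longleftrightarrow>
     locally_compact_space X \<and> Hausdorff_space X \<and>
     proj E ` topspace (total E) = topspace X \<and>
     (\<forall>x\<in>topspace X. Module.module C_ring (fiber E x)) \<and>
     continuous_map (total E) X (proj E) \<and> open_map (total E) X (proj E) \<and>
     continuous_map X (total E) (bzero E) \<and>
     continuous_map (fiber_product E) (total E) (\<lambda>(u, v). badd E u v) \<and>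
     continuous_map (prod_topology euclidean (total E)) (total E) (\<lambda>(c, u). bscale E c u)"

definition bundle_seminorm :: "('e, 'x) bundle_data \<Rightarrow> ('e \<Rightarrow> real) \<Rightarrow> bool" where
  "bundle_seminorm E N \<longleftrightarrow>
     (\<forall>u\<in>topspace (total E). 0 \<le> N u \<and> (\<forall>c. N (bscale E c u) = cmod c * N u)) \<and>
     (\<forall>u\<in>topspace (total E). \<forall>v\<in>topspace (total E).
        proj E u = proj E v \<longrightarrow> N (badd E u v) \<le> N u + N v)"

definition seminorm_dominated ::
    "('e, 'x) bundle_data \<Rightarrow> ('e \<Rightarrow> real) \<Rightarrow> ('e \<Rightarrow> real) \<Rightarrow> real \<Rightarrow> bool" where
  "seminorm_dominated E N N' C \<longleftrightarrow> (\<forall>u\<in>topspace (total E). N u \<le> C * N' u)"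

definition directed_seminorms :: "('e, 'x) bundle_data \<Rightarrow> ('e \<Rightarrow> real) set \<Rightarrow> bool" where
  "directed_seminorms E \<N> \<longleftrightarrow> (\<forall>N\<in>\<N>. bundle_seminorm E N) \<and>
     (\<forall>N\<in>\<N>. \<forall>N'\<in>\<N>. \<exists>C>0. \<exists>N''\<in>\<N>.
        seminorm_dominated E N N'' C \<and> seminorm_dominated E N' N'' C)"

definition seminorms_prec ::
    "('e, 'x) bundle_data \<Rightarrow> ('e \<Rightarrow> real) set \<Rightarrow> ('e \<Rightarrow> real) set \<Rightarrow> bool" where
  "seminorms_prec E \<N> \<N>' \<longleftrightarrow> (\<forall>N\<in>\<N>. \<exists>C>0. \<exists>N'\<in>\<N>'. seminorm_dominated E N N' C)"

definition tube :: "('e, 'x) bundle_data \<Rightarrow> 'x set \<Rightarrow> ('e \<Rightarrow> real) \<Rightarrow> real \<Rightarrow> 'e set" where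
  "tube E U N \<epsilon> = {u \<in> topspace (total E). proj E u \<in> U \<and> N u < \<epsilon>}"

definition admissible :: "'x topology \<Rightarrow> ('e, 'x) bundle_data \<Rightarrow> ('e \<Rightarrow> real) set \<Rightarrow> bool" where
  "admissible X E \<N> \<longleftrightarrow> directed_seminorms E \<N> \<and>
     (\<forall>x\<in>topspace X.
        (\<forall>N\<in>\<N>. \<forall>\<epsilon>>0. \<forall>U. openin X U \<and> x \<in> U \<longrightarrow>
           openin (total E) (tube E U N \<epsilon>) \<and> bzero E x \<in> tube E U N \<epsilon>) \<and>
        (\<forall>W. openin (total E) W \<and> bzero E x \<in> W \<longrightarrow>
           (\<exists>N\<in>\<N>. \<exists>\<epsilon>>0. \<exists>U. openin X U \<and> x \<in> U \<and> tube E U N \<epsilon> \<subseteq> W)))"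

definition seminorms_equiv ::
    "'x topology \<Rightarrow> ('e, 'x) bundle_data \<Rightarrow> (('e \<Rightarrow> real) set \<times> ('e \<Rightarrow> real) set) set" where
  "seminorms_equiv X E = {(\<N>, \<N>'). admissible X E \<N> \<and> admissible X E \<N>' \<and>
     seminorms_prec E \<N> \<N>' \<and> seminorms_prec E \<N>' \<N>}"

definition locally_convex_bundle :: "'x topology \<Rightarrow> ('e, 'x) bundle_data \<Rightarrow> bool" where
  "locally_convex_bundle X E \<longleftrightarrow>
     prebundle X E \<and> unif E \<in> {\<N>. admissible X E \<N>} // seminorms_equiv X E"

definition locally_convex_algebra_bundle :: "'x topology \<Rightarrow> ('e, 'x) bundle_data \<Rightarrow> bool" where
  "locally_convex_algebra_bundle X E \<longleftrightarrow> locally_convex_bundle X E \<and>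
     (\<forall>x\<in>topspace X. complex_algebra (fiber E x)) \<and>
     continuous_map (fiber_product E) (total E) (\<lambda>(u, v). bmult E u v)"

definition frechet_algebra_bundle :: "'x topology \<Rightarrow> ('e, 'x) bundle_data \<Rightarrow> bool" where
  "frechet_algebra_bundle X E \<longleftrightarrow> locally_convex_algebra_bundle X E \<and>
     (\<forall>x\<in>topspace X. frechet_algebra (fiber E x))"

section \<open>The quantum polydisk and the quantum ball\<close>

text \<open>
  The variables are numbered from $0$ to $n-1$.  A formal series is its coefficient function, made
  to vanish outside the set of multi-indices.
\<close>

type_synonym multi_index = "nat \<Rightarrow> nat"
type_synonym series = "multi_index \<Rightarrow> complex"

definition multi_indices :: "nat \<Rightarrow> multi_index set" where
  "multi_indices n = {k. \<forall>i\<ge>n. k i = 0}"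

definition mi_deg :: "nat \<Rightarrow> multi_index \<Rightarrow> nat" where
  "mi_deg n k = (\<Sum>i<n. k i)"

definition w_weight :: "nat \<Rightarrow> complex \<Rightarrow> multi_index \<Rightarrow> real" where
  "w_weight n q k = (if cmod q \<ge> 1 then 1 else cmod q ^ (\<Sum>j<n. \<Sum>i<j. k i * k j))"

definition q_int :: "real \<Rightarrow> nat \<Rightarrow> real" where
  "q_int t m = (\<Sum>i<m. t ^ i)"

definition q_fact :: "real \<Rightarrow> nat \<Rightarrow> real" where
  "q_fact t m = (\<Prod>j=1..m. q_int t j)"

definition mi_q_fact :: "nat \<Rightarrow> real \<Rightarrow> multi_index \<Rightarrow> real" where
  "mi_q_fact n t k = (\<Prod>i<n. q_fact t (k i))"

definition ball_weight :: "nat \<Rightarrow> complex \<Rightarrow> multi_index \<Rightarrow> real" where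
  "ball_weight n q k =
     sqrt (mi_q_fact n (cmod q powi (-2)) k / q_fact (cmod q powi (-2)) (mi_deg n k))"

definition series_norm :: "nat \<Rightarrow> (multi_index \<Rightarrow> real) \<Rightarrow> real \<Rightarrow> series \<Rightarrow> real" where
  "series_norm n w \<rho> a = (\<Sum>\<^sub>\<infinity>k\<in>multi_indices n. cmod (a k) * w k * \<rho> ^ mi_deg n k)"

definition series_space :: "nat \<Rightarrow> (multi_index \<Rightarrow> real) \<Rightarrow> ereal \<Rightarrow> series set" where
  "series_space n w r = {a. (\<forall>k. k \<notin> multi_indices n \<longrightarrow> a k = 0) \<and>
     (\<forall>\<rho>. 0 < \<rho> \<and> ereal \<rho> < r \<longrightarrow>
        (\<lambda>k. cmod (a k) * w k * \<rho> ^ mi_deg n k) summable_on multi_indices n)}"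

definition series_topology :: "nat \<Rightarrow> (multi_index \<Rightarrow> real) \<Rightarrow> ereal \<Rightarrow> series topology" where
  "series_topology n w r = topology_generated_by
     {{b \<in> series_space n w r. series_norm n w \<rho> (\<lambda>k. b k - a k) < \<epsilon>} | a \<rho> \<epsilon>.
        a \<in> series_space n w r \<and> 0 < \<rho> \<and> ereal \<rho> < r \<and> 0 < \<epsilon>}"

text \<open>
  In an algebra with $x_i x_j = q\, x_j x_i$ for $i<j$, reordering the product of two ordered
  monomials gives $x^k x^l = q^{-\sum_{i<j} k_j l_i} x^{k+l}$.  So the continuous multiplication
  which these relations determine has the coefficients in \<open>q_mult\<close>.
\<close>

definition q_twist :: "nat \<Rightarrow> multi_index \<Rightarrow> multi_index \<Rightarrow> nat" where
  "q_twist n k l = (\<Sum>j<n. \<Sum>i<j. k j * l i)"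

definition q_mult :: "nat \<Rightarrow> complex \<Rightarrow> series \<Rightarrow> series \<Rightarrow> series" where
  "q_mult n q a b = (\<lambda>m. if m \<in> multi_indices n
     then \<Sum>k | \<forall>i. k i \<le> m i.
       a k * b (\<lambda>i. m i - k i) * inverse q ^ q_twist n k (\<lambda>i. m i - k i)
     else 0)"

definition x_pow :: "multi_index \<Rightarrow> series" where
  "x_pow k = (\<lambda>m. if m = k then 1 else 0)"

definition q_algebra ::
    "nat \<Rightarrow> (multi_index \<Rightarrow> real) \<Rightarrow> ereal \<Rightarrow> complex \<Rightarrow> series topalg" where
  "q_algebra n w r q = \<lparr>carrier = series_space n w r, monoid.mult = q_mult n q,
     one = x_pow (\<lambda>i. 0), ring.zero = (\<lambda>k. 0), add = (\<lambda>a b k. a k + b k),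
     smult = (\<lambda>c a k. c * a k), topol = series_topology n w r\<rparr>"

definition q_polydisk :: "nat \<Rightarrow> ereal \<Rightarrow> complex \<Rightarrow> series topalg" where
  "q_polydisk n r q = q_algebra n (w_weight n q) r q"

definition q_ball :: "nat \<Rightarrow> ereal \<Rightarrow> complex \<Rightarrow> series topalg" where
  "q_ball n r q = q_algebra n (ball_weight n q) r q"

subsection \<open>The monomials satisfy the defining relations\<close>

lemma finite_le_multi_index:
  assumes "m \<in> multi_indices n"
  shows "finite {k :: multi_index. \<forall>i. k i \<le> m i}"
proof (rule finite_subset)
  show "{k. \<forall>i. k i \<le> m i}
      \<subseteq> {k. \<forall>i. (i \<in> {..<n} \<longrightarrow> k i \<in> {..Max (m ` {..<n})}) \<and> (i \<notin> {..<n} \<longrightarrow> k i = 0)}"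
  proof clarify
    fix k :: multi_index and i
    assume le: "\<forall>i. k i \<le> m i"
    have "k i \<le> Max (m ` {..<n})" if "i < n"
      using that le by (intro order_trans[OF _ Max_ge[of _ "m i"]]) auto
    moreover have "k i = 0" if "\<not> i < n"
    proof -
      have "m i = 0" using assms that by (simp add: multi_indices_def)
      with le show ?thesis by (metis le_zero_eq)
    qed
    ultimately show "(i \<in> {..<n} \<longrightarrow> k i \<in> {..Max (m ` {..<n})}) \<and> (i \<notin> {..<n} \<longrightarrow> k i = 0)"
      by simp
  qed
  show "finite {k. \<forall>i. (i \<in> {..<n} \<longrightarrow> k i \<in> {..Max (m ` {..<n})}) \<and> (i \<notin> {..<n} \<longrightarrow> k i = 0)}"
    by (rule finite_set_of_finite_funs) auto
qed

lemma q_mult_x_pow: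
  assumes "k \<in> multi_indices n" "l \<in> multi_indices n"
  shows "q_mult n q (x_pow k) (x_pow l)
       = (\<lambda>m. inverse q ^ q_twist n k l * x_pow (\<lambda>i. k i + l i) m)"
proof
  fix m :: multi_index
  show "q_mult n q (x_pow k) (x_pow l) m = inverse q ^ q_twist n k l * x_pow (\<lambda>i. k i + l i) m"
  proof (cases "m \<in> multi_indices n")
    case False
    moreover have "(\<lambda>i. k i + l i) \<in> multi_indices n"
      using assms by (simp add: multi_indices_def)
    ultimately show ?thesis by (auto simp: q_mult_def x_pow_def)
  next
    case True
    let ?g = "\<lambda>j. x_pow k j * x_pow l (\<lambda>i. m i - j i) * inverse q ^ q_twist n j (\<lambda>i. m i - j i)"
    have fin: "finite {j :: multi_index. \<forall>i. j i \<le> m i}"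
      by (rule finite_le_multi_index[OF True])
    have "q_mult n q (x_pow k) (x_pow l) m = (\<Sum>j | \<forall>i. j i \<le> m i. ?g j)"
      using True by (simp add: q_mult_def)
    also have "\<dots> = (\<Sum>j | \<forall>i. j i \<le> m i. if j = k then ?g k else 0)"
      by (rule sum.cong) (auto simp: x_pow_def)
    also have "\<dots> = (if \<forall>i. k i \<le> m i then ?g k else 0)"
      using fin by (simp add: sum.delta)
    also have "\<dots> = inverse q ^ q_twist n k l * x_pow (\<lambda>i. k i + l i) m"
    proof (cases "m = (\<lambda>i. k i + l i)")
      case True
      then show ?thesis by (simp add: x_pow_def)
    next
      case False
      then have "\<not> ((\<forall>i. k i \<le> m i) \<and> (\<lambda>i. m i - k i) = l)"
        by (metis le_add_diff_inverse)
      with False show ?thesis by (auto simp: x_pow_def)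
    qed
    finally show ?thesis .
  qed
qed

definition x_gen :: "nat \<Rightarrow> series" where
  "x_gen i = x_pow (\<lambda>j. if j = i then 1 else 0)"

lemma q_twist_gen:
  assumes "i < n"
  shows "q_twist n k (\<lambda>j. if j = i then 1 else 0) = (\<Sum>j\<in>{i<..<n}. k j)"
proof -
  have "q_twist n k (\<lambda>j. if j = i then 1 else 0) = (\<Sum>j<n. if i < j then k j else 0)"
    unfolding q_twist_def by (rule sum.cong) (auto simp: if_distrib cong: if_cong)
  also have "\<dots> = (\<Sum>j\<in>{i<..<n}. k j)"
    by (rule sum.mono_neutral_cong_right) auto
  finally show ?thesis .
qed

lemma x_gen_commute:
  assumes "i < j" "j < n" "q \<noteq> 0"
  shows "q_mult n q (x_gen i) (x_gen j) = (\<lambda>m. q * q_mult n q (x_gen j) (x_gen i) m)"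
proof -
  have mem: "(\<lambda>l. if l = i then 1 else 0) \<in> multi_indices n"
            "(\<lambda>l. if l = j then 1 else 0) \<in> multi_indices n"
    using assms by (auto simp: multi_indices_def)
  have tw: "q_twist n (\<lambda>l. if l = i then 1 else 0) (\<lambda>l. if l = j then 1 else 0) = 0"
           "q_twist n (\<lambda>l. if l = j then 1 else 0) (\<lambda>l. if l = i then 1 else 0) = 1"
    using assms by (simp_all add: q_twist_gen)
  show ?thesis
    unfolding x_gen_def q_mult_x_pow[OF mem] q_mult_x_pow[OF mem(2) mem(1)] tw
    using assms by (simp add: add.commute flip: mult.assoc)
qed

text \<open>Iterating this from $k = 0$, \<open>x_pow k\<close> is the ordered product $x_0^{k_0} \cdots x_{n-1}^{k_{n-1}}$.\<close>

lemma x_pow_mult_gen: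
  assumes "k \<in> multi_indices n" "i < n" "\<And>j. i < j \<Longrightarrow> k j = 0"
  shows "q_mult n q (x_pow k) (x_gen i) = x_pow (k(i := Suc (k i)))"
proof -
  have "(\<lambda>l. if l = i then 1 else 0) \<in> multi_indices n"
    using assms by (auto simp: multi_indices_def)
  moreover have "(\<lambda>l. k l + (if l = i then 1 else 0)) = k(i := Suc (k i))"
    by auto
  ultimately show ?thesis
    using assms by (simp add: x_gen_def q_mult_x_pow q_twist_gen)
qed

end

theory Submission
  imports Defs
begin

text \<open>
  Multiplying the coefficient of $x^k$ by the weight $w_q(k)$ identifies the fiber over $q$,
  isometrically for each $\|\cdot\|_\rho$, with the space $S$ of all $a$ such that
  $\sum_k |a_k| \rho^{|k|} < \infty$ for $\rho < r$, which does not depend on $q$.  So the bundle can be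
  taken to be the product of $\mathbb{C} \setminus \{0\}$ and $S$, and only the multiplication varies:
  in the rescaled coordinates it has the kernel
  $q^{-\sum_{i<j} k_j l_i} w_q(k+l) / (w_q(k) w_q(l))$.  This kernel is continuous in $q$ and bounded by $1$,
  so the multiplication is jointly continuous by dominated convergence.  For the ball, the bound
  says that one summand of the $q$-Vandermonde formula is at most the whole sum.
\<close>

section \<open>Weighted spaces of series\<close>

text \<open>The identity on coefficients is no trivialization: with two or more variables the
  weights for different $q$ admit different series, which is why each coefficient absorbs its
  weight. The price is that all dependence on $q$ sits in the kernel, and the kernel is continuous
  in $q$ only for each fixed pair $(k,l)$. Already at $q = 1$ no modulus of continuity serves all
  pairs, because the exponent \<open>q_twist n k l\<close> is unbounded. So the difference of two
  products is split in such a way that series which move with the point meet only the bound 1 on the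
  kernel, while the variation of the kernel is tested against the fixed pair of series at the base
  point; this is the quantity \<open>defect\<close>, and only there is dominated convergence needed.
  The polydisk and the ball enter solely through the assumptions of \<open>weight_family\<close>,
  and the construction is carried out once for both.\<close>

locale series_weight =
  fixes n :: nat and w :: "multi_index \<Rightarrow> real" and r :: ereal
  assumes weight_pos: "k \<in> multi_indices n \<Longrightarrow> 0 < w k" and radius_pos: "0 < r"
begin

abbreviation S :: "series set" where "S \<equiv> series_space n w r"
abbreviation snorm :: "real \<Rightarrow> series \<Rightarrow> real" where "snorm \<equiv> series_norm n w"
abbreviation radius :: "real \<Rightarrow> bool" where "radius \<rho> \<equiv> 0 < \<rho> \<and> ereal \<rho> < r"
abbreviation sball :: "series \<Rightarrow> real \<Rightarrow> real \<Rightarrow> series set" where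
  "sball a \<rho> \<epsilon> \<equiv> {b \<in> S. snorm \<rho> (\<lambda>k. b k - a k) < \<epsilon>}"

section \<open>The norms and the vector space operations\<close>

lemma term_nonneg:
  assumes "0 < \<rho>" "k \<in> multi_indices n"
  shows "0 \<le> cmod (a k) * w k * \<rho> ^ mi_deg n k"
  using assms weight_pos[of k] by simp

lemma space_summable:
  assumes "a \<in> S" "radius \<rho>"
  shows "(\<lambda>k. cmod (a k) * w k * \<rho> ^ mi_deg n k) summable_on multi_indices n"
  using assms by (simp add: series_space_def)

lemma snorm_nonneg: "0 < \<rho> \<Longrightarrow> 0 \<le> snorm \<rho> a"
  unfolding series_norm_def by (rule infsum_nonneg) (rule term_nonneg)

lemma snorm_scale: "snorm \<rho> (\<lambda>k. c * a k) = cmod c * snorm \<rho> a"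
  unfolding series_norm_def by (simp add: norm_mult mult.assoc infsum_cmult_right')

lemma snorm_minus: "snorm \<rho> (\<lambda>k. b k - a k) = snorm \<rho> (\<lambda>k. a k - b k)"
  unfolding series_norm_def by (simp add: norm_minus_commute)

lemma snorm_zero [simp]: "snorm \<rho> (\<lambda>k. 0) = 0"
  by (simp add: series_norm_def)

lemma space_zero [simp]: "(\<lambda>k. 0) \<in> S"
  by (simp add: series_space_def)

lemma space_scale:
  assumes "a \<in> S"
  shows "(\<lambda>k. c * a k) \<in> S"
  using assms unfolding series_space_def
  by (auto simp: norm_mult mult.assoc intro!: summable_on_cmult_right)

lemma term_add_le:
  assumes "0 < \<rho>" "k \<in> multi_indices n"
  shows "cmod (a k + b k) * w k * \<rho> ^ mi_deg n k
       \<le> cmod (a k) * w k * \<rho> ^ mi_deg n k + cmod (b k) * w k * \<rho> ^ mi_deg n k"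
proof -
  have "cmod (a k + b k) * (w k * \<rho> ^ mi_deg n k) \<le> (cmod (a k) + cmod (b k)) * (w k * \<rho> ^ mi_deg n k)"
    using assms weight_pos[of k] by (intro mult_right_mono norm_triangle_ineq) auto
  then show ?thesis by (simp add: algebra_simps)
qed

lemma space_add:
  assumes "a \<in> S" "b \<in> S"
  shows "(\<lambda>k. a k + b k) \<in> S"
proof -
  have "(\<lambda>k. cmod (a k + b k) * w k * \<rho> ^ mi_deg n k) summable_on multi_indices n" if "radius \<rho>" for \<rho>
    by (rule summable_on_comparison_test[OF summable_on_add[OF space_summable[OF assms(1) that]
            space_summable[OF assms(2) that]]])
      (use that term_add_le term_nonneg[of _ _ "\<lambda>k. a k + b k"] in auto)
  with assms show ?thesis by (simp add: series_space_def)
qed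

lemma snorm_add_le:
  assumes "a \<in> S" "b \<in> S" "radius \<rho>"
  shows "snorm \<rho> (\<lambda>k. a k + b k) \<le> snorm \<rho> a + snorm \<rho> b"
proof -
  note sums = space_summable[OF assms(1,3)] space_summable[OF assms(2,3)]
  show ?thesis
    unfolding series_norm_def infsum_add[OF sums, symmetric]
    by (rule infsum_mono[OF space_summable[OF space_add[OF assms(1,2)] assms(3)] summable_on_add[OF sums]])
      (use assms term_add_le in auto)
qed

lemma space_diff:
  assumes "a \<in> S" "b \<in> S"
  shows "(\<lambda>k. a k - b k) \<in> S"
  using space_add[OF assms(1) space_scale[OF assms(2), of "-1"]] by simp

lemma snorm_triangle:
  assumes "a \<in> S" "b \<in> S" "c \<in> S" "radius \<rho>"
  shows "snorm \<rho> (\<lambda>k. a k - c k) \<le> snorm \<rho> (\<lambda>k. a k - b k) + snorm \<rho> (\<lambda>k. b k - c k)"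
  using snorm_add_le[OF space_diff[OF assms(1,2)] space_diff[OF assms(2,3)] assms(4)] by simp

lemma snorm_mono:
  assumes "a \<in> S" "radius \<rho>" "radius \<sigma>" "\<rho> \<le> \<sigma>"
  shows "snorm \<rho> a \<le> snorm \<sigma> a"
  unfolding series_norm_def
proof (rule infsum_mono[OF space_summable[OF assms(1,2)] space_summable[OF assms(1,3)]])
  fix k assume "k \<in> multi_indices n"
  then show "cmod (a k) * w k * \<rho> ^ mi_deg n k \<le> cmod (a k) * w k * \<sigma> ^ mi_deg n k"
    using assms weight_pos[of k] by (intro mult_left_mono power_mono) auto
qed

text \<open>A single term of a sum of nonnegative terms is at most the sum. Coefficients are
  therefore controlled by any one norm, which separates points and yields the coefficientwise limits
  in \<open>series_space_complete\<close>.\<close>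

lemma coeff_le_snorm:
  assumes "a \<in> S" "radius \<rho>" "k \<in> multi_indices n"
  shows "cmod (a k) * w k * \<rho> ^ mi_deg n k \<le> snorm \<rho> a"
  using finite_sum_le_infsum[OF space_summable[OF assms(1,2)], of "{k}"] assms term_nonneg
  by (simp add: series_norm_def)

lemma snorm_eq_0_iff:
  assumes "a \<in> S" "radius \<rho>"
  shows "snorm \<rho> a = 0 \<longleftrightarrow> a = (\<lambda>k. 0)"
proof
  assume 0: "snorm \<rho> a = 0"
  show "a = (\<lambda>k. 0)"
  proof
    fix k show "a k = 0"
    proof (cases "k \<in> multi_indices n")
      case True
      with coeff_le_snorm[OF assms True] weight_pos[OF True] assms(2) 0
      have "cmod (a k) * (w k * \<rho> ^ mi_deg n k) \<le> 0 * (w k * \<rho> ^ mi_deg n k)" by (simp add: mult.assoc)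
      moreover have "0 < w k * \<rho> ^ mi_deg n k" using weight_pos[OF True] assms(2) by simp
      ultimately have "cmod (a k) \<le> 0" by (rule mult_right_le_imp_le)
      then show ?thesis by simp
    next
      case False
      with assms show ?thesis by (simp add: series_space_def)
    qed
  qed
qed simp

lemma radius_exists: "\<exists>\<rho>. radius \<rho>"
  using ereal_dense2[OF radius_pos] by (auto simp: zero_ereal_def)

text \<open>Norms increase with the radius, so countably many radii approaching \<open>r\<close>
  determine the topology. This is the countability behind metrizability.\<close>

lemma radius_sequence: "\<exists>\<rho> :: nat \<Rightarrow> real. (\<forall>i. radius (\<rho> i)) \<and> (\<forall>\<sigma>. radius \<sigma> \<longrightarrow> (\<exists>i. \<sigma> \<le> \<rho> i))"
proof -
  obtain u where u: "\<And>i. u i < r" "u \<longlonglongrightarrow> r"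
    using approx_from_below_dense_linorder[OF radius_pos] by blast
  obtain \<tau> where \<tau>: "radius \<tau>" using radius_exists by blast
  \<comment> \<open>Early terms of \<open>u\<close> may be negative or minus infinity and hence no
    radii; up to the threshold \<open>\<tau>\<close> they are replaced by \<open>\<tau>\<close>.
    Beyond it \<open>u i\<close> is finite, being less than \<open>r\<close>.\<close>
  define \<rho> where "\<rho> i = (if ereal \<tau> < u i then real_of_ereal (u i) else \<tau>)" for i
  have *: "ereal (\<rho> i) = u i" if "ereal \<tau> < u i" for i
    using that u(1)[of i] by (cases "u i") (auto simp: \<rho>_def)
  have "radius (\<rho> i)" for i
  proof (cases "ereal \<tau> < u i")
    case True
    from *[OF True] True have "ereal \<tau> < ereal (\<rho> i)" by simp
    then have "\<tau> < \<rho> i" by simp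
    with *[OF True] u(1)[of i] \<tau> show ?thesis by auto
  qed (use \<tau> in \<open>simp add: \<rho>_def\<close>)
  moreover have "\<exists>i. \<sigma> \<le> \<rho> i" if "radius \<sigma>" for \<sigma>
  proof -
    \<comment> \<open>The maximum serves two purposes: exceeding \<open>\<tau>\<close> selects the
      first branch in the definition of \<open>\<rho>\<close>, and exceeding \<open>\<sigma>\<close>
      is the goal.\<close>
    have "eventually (\<lambda>i. ereal (max \<sigma> \<tau>) < u i) sequentially"
      using \<tau> that by (intro order_tendstoD[OF u(2)]) (auto simp: max_def)
    then obtain i where i: "ereal (max \<sigma> \<tau>) < u i" by (auto simp: eventually_sequentially)
    then have "ereal \<tau> < u i" by (rule le_less_trans[rotated]) simp
    from *[OF this] i have "\<sigma> \<le> \<rho> i" by (metis ereal_less_eq(3) less_imp_le max.bounded_iff)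
    then show ?thesis by blast
  qed
  ultimately show ?thesis by blast
qed

section \<open>The topology of the norms: base, metrizability, completeness\<close>

lemma topspace_series_topology [simp]: "topspace (series_topology n w r) = S"
proof
  show "topspace (series_topology n w r) \<subseteq> S"
    by (auto simp: series_topology_def topology_generated_by_topspace)
  obtain \<rho> where \<rho>: "radius \<rho>" using radius_exists by blast
  show "S \<subseteq> topspace (series_topology n w r)"
  proof
    fix a assume a: "a \<in> S"
    then have "a \<in> sball a \<rho> 1" by simp
    then show "a \<in> topspace (series_topology n w r)"
      unfolding series_topology_def topology_generated_by_topspace using a \<rho> zero_less_one by blast
  qed
qed

text \<open>The balls are given only as a subbase. They are a base since the larger of two radii
  with the smaller of two bounds fits into an intersection, and the triangle inequality recenters a
  ball at any of its points.\<close>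

lemma openin_series_topology_iff:
  "openin (series_topology n w r) W \<longleftrightarrow>
     W \<subseteq> S \<and> (\<forall>a\<in>W. \<exists>\<rho> \<epsilon>. radius \<rho> \<and> 0 < \<epsilon> \<and> sball a \<rho> \<epsilon> \<subseteq> W)"
proof
  assume "openin (series_topology n w r) W"
  then have "generate_topology_on {sball a \<rho> \<epsilon> | a \<rho> \<epsilon>. a \<in> S \<and> 0 < \<rho> \<and> ereal \<rho> < r \<and> 0 < \<epsilon>} W"
    unfolding series_topology_def openin_topology_generated_by_iff .
  then show "W \<subseteq> S \<and> (\<forall>a\<in>W. \<exists>\<rho> \<epsilon>. radius \<rho> \<and> 0 < \<epsilon> \<and> sball a \<rho> \<epsilon> \<subseteq> W)"
  proof induction
    case Empty
    then show ?case by simp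
  next
    case (Int U V)
    have "\<exists>\<rho> \<epsilon>. radius \<rho> \<and> 0 < \<epsilon> \<and> sball a \<rho> \<epsilon> \<subseteq> U \<inter> V" if a: "a \<in> U \<inter> V" for a
    proof -
      from a Int obtain \<rho> \<epsilon> \<sigma> \<delta> where rad: "radius \<rho>" "0 < \<epsilon>" "sball a \<rho> \<epsilon> \<subseteq> U"
          "radius \<sigma>" "0 < \<delta>" "sball a \<sigma> \<delta> \<subseteq> V"
        by (meson IntD1 IntD2)
      have a: "a \<in> S" using Int a by auto
      have rm: "radius (max \<rho> \<sigma>)" using rad by (auto simp: max_def)
      have "sball a (max \<rho> \<sigma>) (min \<epsilon> \<delta>) \<subseteq> sball a \<rho> \<epsilon> \<inter> sball a \<sigma> \<delta>"
        using snorm_mono[OF space_diff[OF _ a] rad(1) rm] snorm_mono[OF space_diff[OF _ a] rad(4) rm]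
        by fastforce
      with rad rm show ?thesis by (intro exI[of _ "max \<rho> \<sigma>"] exI[of _ "min \<epsilon> \<delta>"]) auto
    qed
    with Int show ?case by auto
  next
    case (UN K)
    then show ?case by (meson Sup_upper Union_iff Sup_least order_trans)
  next
    case (Basis U)
    then obtain a \<rho> \<epsilon> where U: "U = sball a \<rho> \<epsilon>" and a: "a \<in> S" and \<rho>: "radius \<rho>" by auto
    have "\<exists>\<rho>' \<delta>. radius \<rho>' \<and> 0 < \<delta> \<and> sball b \<rho>' \<delta> \<subseteq> U" if "b \<in> U" for b
    proof -
      from that have b: "b \<in> S" "snorm \<rho> (\<lambda>k. b k - a k) < \<epsilon>" by (auto simp: U)
      have "sball b \<rho> (\<epsilon> - snorm \<rho> (\<lambda>k. b k - a k)) \<subseteq> U"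
        using snorm_triangle[OF _ b(1) a \<rho>] by (fastforce simp: U)
      with b \<rho> show ?thesis by (intro exI[of _ \<rho>] exI[of _ "\<epsilon> - snorm \<rho> (\<lambda>k. b k - a k)"]) auto
    qed
    with U show ?case by auto
  qed
next
  assume W: "W \<subseteq> S \<and> (\<forall>a\<in>W. \<exists>\<rho> \<epsilon>. radius \<rho> \<and> 0 < \<epsilon> \<and> sball a \<rho> \<epsilon> \<subseteq> W)"
  have "\<exists>T. openin (series_topology n w r) T \<and> a \<in> T \<and> T \<subseteq> W" if "a \<in> W" for a
  proof -
    from W that obtain \<rho> \<epsilon> where "radius \<rho>" "0 < \<epsilon>" "sball a \<rho> \<epsilon> \<subseteq> W" and a: "a \<in> S" by blast
    moreover then have "openin (series_topology n w r) (sball a \<rho> \<epsilon>)"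
      unfolding series_topology_def by (intro topology_generated_by_Basis) blast
    ultimately show ?thesis by (intro exI[of _ "sball a \<rho> \<epsilon>"]) simp
  qed
  then show "openin (series_topology n w r) W" by (subst openin_subopen) blast
qed

lemma openin_sball:
  assumes "a \<in> S" "radius \<rho>"
  shows "openin (series_topology n w r) (sball a \<rho> \<epsilon>)"
proof (cases "0 < \<epsilon>")
  case True
  then show ?thesis
    unfolding series_topology_def using assms by (intro topology_generated_by_Basis) blast
next
  case False
  have "\<not> snorm \<rho> (\<lambda>k. b k - a k) < \<epsilon>" for b
    using snorm_nonneg[of \<rho> "\<lambda>k. b k - a k"] assms(2) False by linarith
  then have "sball a \<rho> \<epsilon> = {}" by simp
  then show ?thesis by (metis openin_empty)
qed

text \<open>Reduces continuity to one norm estimate at a time. The bundle operations and the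
  isomorphisms of the fibers are all handled in this form.\<close>

lemma continuous_map_into_series:
  "continuous_map Y (series_topology n w r) f \<longleftrightarrow>
     f \<in> topspace Y \<rightarrow> S \<and>
     (\<forall>y\<in>topspace Y. \<forall>\<rho> \<epsilon>. radius \<rho> \<and> 0 < \<epsilon> \<longrightarrow>
        (\<exists>U. openin Y U \<and> y \<in> U \<and> (\<forall>z\<in>U. snorm \<rho> (\<lambda>k. f z k - f y k) < \<epsilon>)))"
proof
  assume f: "continuous_map Y (series_topology n w r) f"
  then have S: "f \<in> topspace Y \<rightarrow> S" by (simp add: continuous_map_def)
  moreover have "\<exists>U. openin Y U \<and> y \<in> U \<and> (\<forall>z\<in>U. snorm \<rho> (\<lambda>k. f z k - f y k) < \<epsilon>)"
    if "y \<in> topspace Y" "radius \<rho> \<and> 0 < \<epsilon>" for y \<rho> \<epsilon>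
  proof (intro exI conjI)
    show "openin Y {z \<in> topspace Y. f z \<in> sball (f y) \<rho> \<epsilon>}"
      using S that by (intro openin_continuous_map_preimage[OF f] openin_sball) auto
    show "y \<in> {z \<in> topspace Y. f z \<in> sball (f y) \<rho> \<epsilon>}" using S that by auto
  qed auto
  ultimately show "f \<in> topspace Y \<rightarrow> S \<and>
     (\<forall>y\<in>topspace Y. \<forall>\<rho> \<epsilon>. radius \<rho> \<and> 0 < \<epsilon> \<longrightarrow>
        (\<exists>U. openin Y U \<and> y \<in> U \<and> (\<forall>z\<in>U. snorm \<rho> (\<lambda>k. f z k - f y k) < \<epsilon>)))" by blast
next
  assume R: "f \<in> topspace Y \<rightarrow> S \<and>
     (\<forall>y\<in>topspace Y. \<forall>\<rho> \<epsilon>. radius \<rho> \<and> 0 < \<epsilon> \<longrightarrow>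
        (\<exists>U. openin Y U \<and> y \<in> U \<and> (\<forall>z\<in>U. snorm \<rho> (\<lambda>k. f z k - f y k) < \<epsilon>)))"
  have "openin Y {y \<in> topspace Y. f y \<in> W}" if W: "openin (series_topology n w r) W" for W
  proof (subst openin_subopen, safe)
    fix y assume y: "y \<in> topspace Y" "f y \<in> W"
    from W y(2) obtain \<rho> \<epsilon> where \<rho>: "radius \<rho>" "0 < \<epsilon>" "sball (f y) \<rho> \<epsilon> \<subseteq> W"
      unfolding openin_series_topology_iff by blast
    with R y obtain U where U: "openin Y U" "y \<in> U" "\<forall>z\<in>U. snorm \<rho> (\<lambda>k. f z k - f y k) < \<epsilon>" by blast
    have "U \<subseteq> topspace Y" using U(1) by (rule openin_subset)
    with U R \<rho>(3) have "U \<subseteq> {y \<in> topspace Y. f y \<in> W}" by blast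
    with U show "\<exists>T. openin Y T \<and> y \<in> T \<and> T \<subseteq> {y \<in> topspace Y. f y \<in> W}" by blast
  qed
  with R show "continuous_map Y (series_topology n w r) f" by (simp add: continuous_map_def)
qed

lemma metrizable_series_topology: "metrizable_space (series_topology n w r)"
proof -
  obtain \<rho> :: "nat \<Rightarrow> real" where \<rho>: "\<And>i. radius (\<rho> i)" "\<And>\<sigma>. radius \<sigma> \<Longrightarrow> \<exists>i. \<sigma> \<le> \<rho> i"
    using radius_sequence by blast
  \<comment> \<open>The caps \<open>1 / Suc i\<close> tend to 0, so for a given bound only finitely
    many norms affect the supremum \<open>d\<close>.\<close>
  define D where "D a b i = min (1 / real (Suc i)) (snorm (\<rho> i) (\<lambda>k. a k - b k))" for a b i
  define d where "d a b = (SUP i. D a b i)" for a b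
  have D0: "0 \<le> D a b i" for a b i
    using snorm_nonneg \<rho>(1) by (simp add: D_def)
  have D1: "D a b i \<le> 1 / real (Suc i)" for a b i
    by (simp add: D_def)
  have bdd: "bdd_above (range (D a b))" for a b
  proof (rule bdd_aboveI2)
    show "D a b i \<le> 1" for i by (rule order_trans[OF D1]) simp
  qed
  have Dd: "D a b i \<le> d a b" for a b i
    unfolding d_def by (rule cSUP_upper[OF UNIV_I bdd])
  interpret d: Metric_space S d
  proof
    show "0 \<le> d a b" for a b using order_trans[OF D0 Dd] .
    show "d a b = d b a" for a b by (simp add: d_def D_def snorm_minus[of _ a b])
    show "d a b = 0 \<longleftrightarrow> a = b" if ab: "a \<in> S" "b \<in> S" for a b
    proof
      assume "d a b = 0"
      with Dd[of a b 0] have "D a b 0 \<le> 0" by simp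
      then have "snorm (\<rho> 0) (\<lambda>k. a k - b k) \<le> 0" by (simp add: D_def min_def split: if_splits)
      then have "snorm (\<rho> 0) (\<lambda>k. a k - b k) = 0"
        using snorm_nonneg \<rho>(1) by (intro order_antisym) auto
      then have "(\<lambda>k. a k - b k) = (\<lambda>k. 0)"
        using snorm_eq_0_iff[OF space_diff[OF ab] \<rho>(1)] by simp
      then show "a = b" by (simp add: fun_eq_iff)
    qed (simp add: d_def D_def)
    show "d a c \<le> d a b + d b c" if "a \<in> S" "b \<in> S" "c \<in> S" for a b c
      unfolding d_def[of a c]
    proof (rule cSUP_least)
      fix i
      \<comment> \<open>Truncation at a nonnegative constant preserves subadditivity, so each
        \<open>D _ _ i\<close> keeps the triangle inequality.\<close>
      have min_add: "min c z \<le> min c x + min c y"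
        if "z \<le> x + y" "0 \<le> x" "0 \<le> y" "0 \<le> c" for c x y z :: real
        using that by (simp add: min_def)
      have "D a c i \<le> D a b i + D b c i"
        unfolding D_def by (rule min_add[OF snorm_triangle[OF that \<rho>(1)]]) (simp_all add: snorm_nonneg \<rho>(1))
      with Dd[of a b i] Dd[of b c i] show "D a c i \<le> d a b + d b c" by linarith
    qed simp
  qed
  have "openin (series_topology n w r) W \<longleftrightarrow> openin d.mtopology W" for W
  proof -
    have "(\<exists>\<sigma> \<epsilon>. radius \<sigma> \<and> 0 < \<epsilon> \<and> sball a \<sigma> \<epsilon> \<subseteq> W) \<longleftrightarrow> (\<exists>\<epsilon>>0. d.mball a \<epsilon> \<subseteq> W)" if a: "a \<in> S" for a
    proof
      assume "\<exists>\<sigma> \<epsilon>. radius \<sigma> \<and> 0 < \<epsilon> \<and> sball a \<sigma> \<epsilon> \<subseteq> W"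
      then obtain \<sigma> \<epsilon> where \<sigma>: "radius \<sigma>" "0 < \<epsilon>" "sball a \<sigma> \<epsilon> \<subseteq> W" by blast
      then obtain i where i: "\<sigma> \<le> \<rho> i" using \<rho>(2) by blast
      \<comment> \<open>A value of \<open>D a b i\<close> below the cap \<open>1 / Suc i\<close>
        must be the norm itself, so the truncation does no harm.\<close>
      have "d.mball a (min \<epsilon> (1 / real (Suc i))) \<subseteq> sball a \<sigma> \<epsilon>"
      proof
        fix b assume "b \<in> d.mball a (min \<epsilon> (1 / real (Suc i)))"
        then have b: "b \<in> S" and db: "d a b < min \<epsilon> (1 / real (Suc i))" by auto
        have "D a b i < min \<epsilon> (1 / real (Suc i))" using Dd db by (rule le_less_trans)
        then have "snorm (\<rho> i) (\<lambda>k. a k - b k) < \<epsilon>" by (auto simp: D_def min_def split: if_splits)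
        moreover have "snorm \<sigma> (\<lambda>k. a k - b k) \<le> snorm (\<rho> i) (\<lambda>k. a k - b k)"
          using snorm_mono[OF space_diff[OF a b] \<sigma>(1) \<rho>(1) i] .
        ultimately show "b \<in> sball a \<sigma> \<epsilon>" using b snorm_minus[of \<sigma> b a] by simp
      qed
      with \<sigma> show "\<exists>\<epsilon>>0. d.mball a \<epsilon> \<subseteq> W" by (intro exI[of _ "min \<epsilon> (1 / real (Suc i))"]) auto
    next
      assume "\<exists>\<epsilon>>0. d.mball a \<epsilon> \<subseteq> W"
      then obtain \<epsilon> where \<epsilon>: "0 < \<epsilon>" "d.mball a \<epsilon> \<subseteq> W" by blast
      \<comment> \<open>From index \<open>m\<close> on the caps alone are below
        \<open>\<epsilon> / 2\<close>; the remaining finitely many norms are dominated by the one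
        with the largest radius \<open>\<sigma>\<close>. Half of \<open>\<epsilon>\<close> is used
        because a supremum turns strict bounds into weak ones.\<close>
      then obtain m where m: "1 / real (Suc m) < \<epsilon> / 2" using nat_approx_posE[of "\<epsilon> / 2"] by auto
      define \<sigma> where "\<sigma> = Max (\<rho> ` {..m})"
      have "\<sigma> \<in> \<rho> ` {..m}" unfolding \<sigma>_def by (rule Max_in) auto
      then have \<sigma>: "radius \<sigma>" using \<rho>(1) by blast
      have "sball a \<sigma> (\<epsilon> / 2) \<subseteq> d.mball a \<epsilon>"
      proof
        fix b assume "b \<in> sball a \<sigma> (\<epsilon> / 2)"
        then have b: "b \<in> S" and sb: "snorm \<sigma> (\<lambda>k. a k - b k) < \<epsilon> / 2" by (auto simp: snorm_minus[of _ b a])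
        have "D a b i \<le> \<epsilon> / 2" for i
        proof (cases "i \<le> m")
          case True
          then have "\<rho> i \<le> \<sigma>" by (auto simp: \<sigma>_def)
          from snorm_mono[OF space_diff[OF a b] \<rho>(1) \<sigma> this] sb show ?thesis by (simp add: D_def)
        next
          case False
          then have "1 / real (Suc i) \<le> 1 / real (Suc m)" by (simp add: field_simps)
          with m D1[of a b i] show ?thesis by linarith
        qed
        then have "d a b \<le> \<epsilon> / 2" unfolding d_def by (intro cSUP_least) auto
        with \<epsilon> a b show "b \<in> d.mball a \<epsilon>" by simp
      qed
      with \<sigma> \<epsilon> show "\<exists>\<sigma> \<epsilon>. radius \<sigma> \<and> 0 < \<epsilon> \<and> sball a \<sigma> \<epsilon> \<subseteq> W"
        by (intro exI[of _ \<sigma>] exI[of _ "\<epsilon> / 2"]) auto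
    qed
    then show ?thesis unfolding openin_series_topology_iff d.openin_mtopology by blast
  qed
  then have "series_topology n w r = d.mtopology" by (simp add: topology_eq)
  then show ?thesis by (simp add: d.metrizable_space_mtopology)
qed

text \<open>The limit is taken coefficient by coefficient in the complex numbers. That it is also a
  limit in norm is a Fatou argument: finite partial sums of the norm pass to the limit, and their
  common bound survives for the infinite sum.\<close>

lemma series_space_complete:
  assumes F: "F \<noteq> bot"
    and cauchy: "\<And>\<rho> \<epsilon>. radius \<rho> \<Longrightarrow> 0 < \<epsilon> \<Longrightarrow>
      \<exists>A\<subseteq>S. eventually (\<lambda>a. a \<in> A) F \<and> (\<forall>a\<in>A. \<forall>b\<in>A. snorm \<rho> (\<lambda>k. a k - b k) < \<epsilon>)"
  shows "\<exists>l\<in>S. \<forall>\<rho> \<epsilon>. radius \<rho> \<and> 0 < \<epsilon> \<longrightarrow> eventually (\<lambda>a. a \<in> sball l \<rho> \<epsilon>) F"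
proof -
  obtain \<sigma> where \<sigma>: "radius \<sigma>" using radius_exists by blast
  have "\<exists>z. ((\<lambda>a. a k) \<longlongrightarrow> z) F" if k: "k \<in> multi_indices n" for k
  proof -
    have pos: "0 < w k * \<sigma> ^ mi_deg n k" using weight_pos[OF k] \<sigma> by simp
    have "cauchy_filter (filtermap (\<lambda>a. a k) F)"
      unfolding cauchy_filter_metric_filtermap
    proof (intro allI impI)
      fix e :: real assume "0 < e"
      \<comment> \<open>The bound is \<open>e\<close> times the factor of the \<open>k\<close>-th
        coefficient in the norm, so that dividing by this factor leaves \<open>e\<close>.\<close>
      with pos have "0 < e * (w k * \<sigma> ^ mi_deg n k)" by simp
      from cauchy[OF \<sigma> this] obtain A where A: "A \<subseteq> S" "eventually (\<lambda>a. a \<in> A) F"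
        "\<And>a b. a \<in> A \<Longrightarrow> b \<in> A \<Longrightarrow> snorm \<sigma> (\<lambda>k. a k - b k) < e * (w k * \<sigma> ^ mi_deg n k)" by blast
      have "dist (a k) (b k) < e" if "a \<in> A" "b \<in> A" for a b
      proof -
        have "a \<in> S" "b \<in> S" using that A by auto
        from coeff_le_snorm[OF space_diff[OF this] \<sigma> k] A(3)[OF that]
        have "cmod (a k - b k) * (w k * \<sigma> ^ mi_deg n k) < e * (w k * \<sigma> ^ mi_deg n k)"
          by (simp add: mult.assoc)
        then show ?thesis unfolding dist_norm mult_less_cancel_right_pos[OF pos] .
      qed
      with A(2) show "\<exists>P. eventually P F \<and> (\<forall>a b. P a \<and> P b \<longrightarrow> dist (a k) (b k) < e)"
        by (intro exI[of _ "\<lambda>a. a \<in> A"]) blast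
    qed
    moreover have "filtermap (\<lambda>a. a k) F \<noteq> bot" using F by (simp add: filtermap_bot_iff)
    ultimately have "\<exists>z\<in>UNIV. filtermap (\<lambda>a. a k) F \<le> nhds z"
      using complete_UNIV[where 'a = complex, unfolded complete_uniform, rule_format] by simp
    then show ?thesis by (simp add: filterlim_def)
  qed
  then obtain l0 where l0: "\<And>k. k \<in> multi_indices n \<Longrightarrow> ((\<lambda>a. a k) \<longlongrightarrow> l0 k) F" by metis
  define l where "l k = (if k \<in> multi_indices n then l0 k else 0)" for k
  have lim: "((\<lambda>a. a k) \<longlongrightarrow> l k) F" if "k \<in> multi_indices n" for k
    using l0 that by (simp add: l_def)
  \<comment> \<open>On a finite \<open>K\<close> the estimate for \<open>a - b\<close> passes to the
    limit in \<open>b\<close>. The bound \<open>\<epsilon>\<close> is independent of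
    \<open>K\<close>, which gives summability and the norm estimate at once.\<close>
  have key: "(\<lambda>k. cmod (a k - l k) * w k * \<rho> ^ mi_deg n k) summable_on multi_indices n \<and>
      snorm \<rho> (\<lambda>k. a k - l k) \<le> \<epsilon>"
    if A: "A \<subseteq> S" "eventually (\<lambda>a. a \<in> A) F" "\<And>a b. a \<in> A \<Longrightarrow> b \<in> A \<Longrightarrow> snorm \<rho> (\<lambda>k. a k - b k) < \<epsilon>"
      and a: "a \<in> A" and \<rho>: "radius \<rho>" for A a \<rho> \<epsilon>
  proof -
    let ?f = "\<lambda>k. cmod (a k - l k) * w k * \<rho> ^ mi_deg n k"
    have bound: "sum ?f K \<le> \<epsilon>" if K: "finite K" "K \<subseteq> multi_indices n" for K
    proof (rule tendsto_upperbound[OF _ _ F])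
      show "((\<lambda>b. \<Sum>k\<in>K. cmod (a k - b k) * w k * \<rho> ^ mi_deg n k) \<longlongrightarrow> sum ?f K) F"
        using K lim by (intro tendsto_intros) auto
      show "eventually (\<lambda>b. (\<Sum>k\<in>K. cmod (a k - b k) * w k * \<rho> ^ mi_deg n k) \<le> \<epsilon>) F"
        using A(2)
      proof eventually_elim
        case (elim b)
        have ab: "(\<lambda>k. a k - b k) \<in> S" using a elim A(1) by (intro space_diff) auto
        have "(\<Sum>k\<in>K. cmod (a k - b k) * w k * \<rho> ^ mi_deg n k) \<le> snorm \<rho> (\<lambda>k. a k - b k)"
          unfolding series_norm_def
          by (rule finite_sum_le_infsum[OF space_summable[OF ab \<rho>] K])
            (rule term_nonneg, use \<rho> in simp_all)
        with A(3)[OF a elim] show ?case by simp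
      qed
    qed
    have nonneg: "0 \<le> ?f k" if "k \<in> multi_indices n" for k
      using \<rho> that by (intro term_nonneg[of \<rho> k "\<lambda>k. a k - l k"]) auto
    have sum: "?f summable_on multi_indices n"
      by (rule nonneg_bdd_above_summable_on[OF nonneg bdd_aboveI2[where M = \<epsilon>]]) (simp_all add: bound)
    then have "infsum ?f (multi_indices n) \<le> \<epsilon>"
      by (rule infsum_le_finite_sums) (rule bound)
    with sum show ?thesis by (simp add: series_norm_def)
  qed
  have "l \<in> S"
  proof -
    have "(\<lambda>k. cmod (l k) * w k * \<rho> ^ mi_deg n k) summable_on multi_indices n" if \<rho>: "radius \<rho>" for \<rho>
    proof -
      \<comment> \<open>Membership of \<open>l\<close> follows from \<open>l = a + (l - a)\<close>
        with any one \<open>a\<close> from a Cauchy set; the size 1 of that set is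
        arbitrary.\<close>
      from cauchy[OF \<rho> zero_less_one] obtain A where A: "A \<subseteq> S" "eventually (\<lambda>a. a \<in> A) F"
        "\<And>a b. a \<in> A \<Longrightarrow> b \<in> A \<Longrightarrow> snorm \<rho> (\<lambda>k. a k - b k) < 1" by blast
      from eventually_happens'[OF F A(2)] obtain a where a: "a \<in> A" by blast
      have "a \<in> S" using a A by auto
      from summable_on_add[OF space_summable[OF this \<rho>] conjunct1[OF key[OF A a \<rho>]]]
      show ?thesis
      proof (rule summable_on_comparison_test)
        fix k assume k: "k \<in> multi_indices n"
        show "0 \<le> cmod (l k) * w k * \<rho> ^ mi_deg n k" using k \<rho> by (intro term_nonneg) auto
        show "cmod (l k) * w k * \<rho> ^ mi_deg n k
            \<le> cmod (a k) * w k * \<rho> ^ mi_deg n k + cmod (a k - l k) * w k * \<rho> ^ mi_deg n k"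
          using term_add_le[of \<rho> k a "\<lambda>k. l k - a k"] \<rho> k by (simp add: norm_minus_commute)
      qed
    qed
    then show ?thesis by (simp add: series_space_def l_def)
  qed
  moreover have "eventually (\<lambda>a. a \<in> sball l \<rho> \<epsilon>) F" if \<rho>: "radius \<rho>" and \<epsilon>: "0 < \<epsilon>" for \<rho> \<epsilon>
  proof -
    \<comment> \<open>Passing to the limit weakens the strict bound, so
      \<open>\<epsilon> / 2\<close> is needed for a strict \<open>\<epsilon>\<close>.\<close>
    from cauchy[OF \<rho> half_gt_zero[OF \<epsilon>]] obtain A where A: "A \<subseteq> S" "eventually (\<lambda>a. a \<in> A) F"
      "\<And>a b. a \<in> A \<Longrightarrow> b \<in> A \<Longrightarrow> snorm \<rho> (\<lambda>k. a k - b k) < \<epsilon> / 2" by blast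
    show ?thesis using A(2)
    proof eventually_elim
      case (elim a)
      have "snorm \<rho> (\<lambda>k. a k - l k) \<le> \<epsilon> / 2" using key[OF A elim \<rho>] ..
      moreover have "\<epsilon> / 2 < \<epsilon>" using \<epsilon> by simp
      moreover have "a \<in> S" using elim A(1) ..
      ultimately show ?case by simp
    qed
  qed
  ultimately show ?thesis by blast
qed

end

section \<open>The weights of the polydisk and of the ball\<close>

lemma mi_deg_add: "mi_deg n (\<lambda>i. k i + l i) = mi_deg n k + mi_deg n l"
  by (simp add: mi_deg_def sum.distrib)

lemma multi_indices_add:
  "k \<in> multi_indices n \<Longrightarrow> l \<in> multi_indices n \<Longrightarrow> (\<lambda>i. k i + l i) \<in> multi_indices n"
  by (simp add: multi_indices_def)

lemma multi_indices_zero [simp]: "(\<lambda>i. 0) \<in> multi_indices n"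
  by (simp add: multi_indices_def)

lemma multi_indices_le:
  assumes "m \<in> multi_indices n" "\<And>i. k i \<le> m i"
  shows "k \<in> multi_indices n"
proof -
  have "k i = 0" if "n \<le> i" for i
    using assms(2)[of i] assms(1) that by (simp add: multi_indices_def)
  then show ?thesis by (simp add: multi_indices_def)
qed

lemma q_twist_add_left: "q_twist n (\<lambda>i. k i + l i) m = q_twist n k m + q_twist n l m"
  by (simp add: q_twist_def algebra_simps sum.distrib)

lemma q_twist_add_right: "q_twist n k (\<lambda>i. l i + m i) = q_twist n k l + q_twist n k m"
  by (simp add: q_twist_def algebra_simps sum.distrib)

lemma q_twist_zero [simp]: "q_twist n (\<lambda>i. 0) l = 0" "q_twist n k (\<lambda>i. 0) = 0"
  by (simp_all add: q_twist_def)

lemma q_twist_Suc: "q_twist (Suc n) k l = q_twist n k l + k n * mi_deg n l"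
  by (simp add: q_twist_def mi_deg_def sum_distrib_left)

text \<open>Merging the two cases into a power of one minimum makes continuity across the circle
  $|q| = 1$ evident and spares a case distinction below.\<close>

lemma w_weight_eq: "w_weight n q k = min 1 (cmod q) ^ (\<Sum>j<n. \<Sum>i<j. k i * k j)"
  by (simp add: w_weight_def min_def)

text \<open>The exponent of the weight is a quadratic form whose polarization is
  \<open>q_twist n k l + q_twist n l k\<close>. The first summand compensates the negative power of
  $|q|$, since \<open>min 1 (cmod q) / cmod q\<close> is at most 1, and the second gives another
  factor at most 1.\<close>

lemma w_weight_submultiplicative:
  assumes "q \<noteq> 0"
  shows "inverse (cmod q) ^ q_twist n k l * w_weight n q (\<lambda>i. k i + l i)
       \<le> w_weight n q k * w_weight n q l"
proof -
  define e where "e k = (\<Sum>j<n. \<Sum>i<j. k i * k j)" for k :: multi_index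
  define m where "m = min 1 (cmod q)"
  have m: "0 < m" "m \<le> 1" "m \<le> cmod q" using assms by (auto simp: m_def)
  have e: "e (\<lambda>i. k i + l i) = e k + e l + q_twist n l k + q_twist n k l"
    unfolding e_def q_twist_def by (simp add: algebra_simps sum.distrib)
  have "inverse (cmod q) ^ q_twist n k l * m ^ e (\<lambda>i. k i + l i)
      = (inverse (cmod q) * m) ^ q_twist n k l * m ^ q_twist n l k * (m ^ e k * m ^ e l)"
    unfolding e power_add power_mult_distrib by (simp only: ac_simps)
  also have "\<dots> \<le> m ^ e k * m ^ e l"
  proof (rule mult_left_le_one_le)
    have "inverse (cmod q) * m \<le> 1" using m assms by (simp add: inverse_eq_divide)
    then have "(inverse (cmod q) * m) ^ q_twist n k l \<le> 1"
      using m by (intro power_le_one) auto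
    moreover have "m ^ q_twist n l k \<le> 1" using m by (intro power_le_one) auto
    ultimately show "(inverse (cmod q) * m) ^ q_twist n k l * m ^ q_twist n l k \<le> 1"
      using m by (intro mult_le_one) auto
  qed (use m in auto)
  finally show ?thesis by (simp add: w_weight_eq e_def m_def)
qed

section \<open>Gaussian binomials and the weight of the ball\<close>

lemma q_int_pos: "0 < t \<Longrightarrow> 0 < m \<Longrightarrow> 0 < q_int t m"
  unfolding q_int_def by (intro sum_pos) auto

lemma q_int_add: "q_int t (a + b) = q_int t a + t ^ a * q_int t b"
  by (induction b) (simp_all add: q_int_def algebra_simps power_add)

lemma q_fact_0 [simp]: "q_fact t 0 = 1"
  by (simp add: q_fact_def)

lemma q_fact_Suc: "q_fact t (Suc m) = q_int t (Suc m) * q_fact t m"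
  by (simp add: q_fact_def)

lemma q_fact_pos: "0 < t \<Longrightarrow> 0 < q_fact t m"
  unfolding q_fact_def by (intro prod_pos) (auto intro: q_int_pos)

text \<open>The Gaussian binomial coefficient of \<open>a + b\<close> over \<open>a\<close>. It is
  indexed by the two complementary parts, so no truncated subtraction arises.\<close>

definition q_binomial :: "real \<Rightarrow> nat \<Rightarrow> nat \<Rightarrow> real" where
  "q_binomial t a b = q_fact t (a + b) / (q_fact t a * q_fact t b)"

lemma q_binomial_pos: "0 < t \<Longrightarrow> 0 < q_binomial t a b"
  unfolding q_binomial_def using q_fact_pos by simp

lemma q_binomial_0 [simp]:
  assumes "0 < t"
  shows "q_binomial t a 0 = 1" "q_binomial t 0 b = 1"
  using q_fact_pos[OF assms, of a] q_fact_pos[OF assms, of b] by (simp_all add: q_binomial_def)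

text \<open>The top factor of the numerator splits by \<open>q_int_add\<close> into the
  \<open>q_int\<close> of \<open>Suc b\<close> and \<open>t ^ Suc b\<close> times the
  \<open>q_int\<close> of \<open>Suc a\<close>; each piece cancels one factor of the
  denominator.\<close>

lemma q_pascal:
  assumes t: "0 < t"
  shows "q_binomial t (Suc a) (Suc b) = t ^ Suc b * q_binomial t a (Suc b) + q_binomial t (Suc a) b"
proof -
  have "q_fact t (Suc a + Suc b) = (q_int t (Suc b) + t ^ Suc b * q_int t (Suc a)) * q_fact t (Suc (a + b))"
    unfolding q_int_add[symmetric] by (simp add: q_fact_Suc add.commute)
  moreover note q_fact_pos[OF t, of a] q_fact_pos[OF t, of b] q_int_pos[OF t, of "Suc a"] q_int_pos[OF t, of "Suc b"]
  ultimately show ?thesis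
    unfolding q_binomial_def q_fact_Suc[of t a] q_fact_Suc[of t b] add_Suc_right add_Suc
    by (simp add: field_simps)
qed

text \<open>The left-hand side is a single summand of the \<open>q\<close>-Vandermonde expansion of the right-hand side.\<close>

lemma q_vandermonde_summand_le:
  assumes t: "0 < t"
  shows "t ^ (c * b) * q_binomial t a b * q_binomial t c d \<le> q_binomial t (a + c) (b + d)"
\<comment> \<open>Both terms of the Pascal rule lower \<open>c + d\<close> by one. If
  \<open>c\<close> or \<open>d\<close> is 0, it is enough to drop one nonnegative term of that rule
  on the right; otherwise it is applied on both sides.\<close>
proof (induction "c + d" arbitrary: c d)
  case 0
  then show ?case using t by simp
next
  case (Suc m)
  have pascal_ge: "t ^ v * q_binomial t u v \<le> q_binomial t (Suc u) v" "q_binomial t u v \<le> q_binomial t u (Suc v)" for u v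
  proof -
    show "t ^ v * q_binomial t u v \<le> q_binomial t (Suc u) v"
      using q_pascal[OF t, of u] q_binomial_pos[OF t, of "Suc u"] t
      by (cases v) (auto intro: less_imp_le)
    show "q_binomial t u v \<le> q_binomial t u (Suc v)"
      using q_pascal[OF t, of _ v] q_binomial_pos[OF t, of _ "Suc v"] t
      by (cases u) (auto intro: less_imp_le)
  qed
  consider "c = 0" "d = Suc m" | "d = 0" "c = Suc m" | c' d' where "c = Suc c'" "d = Suc d'"
    using Suc.hyps(2) by (cases c; cases d) auto
  then show ?case
  proof cases
    case 1
    with Suc.hyps(1)[of 0 m] pascal_ge(2)[of a "b + m"] t show ?thesis by simp
  next
    case 2
    have "t ^ b * (t ^ (m * b) * q_binomial t a b) \<le> t ^ b * q_binomial t (a + m) b"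
      using Suc.hyps(1)[of m 0] t by (intro mult_left_mono) auto
    also have "\<dots> \<le> q_binomial t (a + c) b" using pascal_ge(1)[of b "a + m"] 2 by simp
    finally show ?thesis using 2 t by (simp add: power_add mult.assoc)
  next
    case 3
    \<comment> \<open>With \<open>c = Suc c'\<close>, the power \<open>t ^ (c * b) * t ^ d\<close>
      equals \<open>t ^ (b + d) * t ^ (c' * b)\<close>, and \<open>t ^ (b + d)\<close> is exactly
      what the Pascal rule puts before the corresponding term of the right-hand side.\<close>
    have "t ^ (c * b) * q_binomial t a b * q_binomial t c d
        = t ^ (b + d) * (t ^ (c' * b) * q_binomial t a b * q_binomial t c' d)
          + t ^ (c * b) * q_binomial t a b * q_binomial t c d'"
      using 3 by (simp add: q_pascal[OF t] algebra_simps power_add)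
    also have "\<dots> \<le> t ^ (b + d) * q_binomial t (a + c') (b + d) + q_binomial t (a + c) (b + d')"
      using Suc.hyps(1)[of c' d] Suc.hyps(1)[of c d'] Suc.hyps(2) 3 t by (intro add_mono mult_left_mono) auto
    also have "\<dots> = q_binomial t (a + c) (b + d)"
      using 3 q_pascal[OF t, of "a + c'" "b + d'"] by simp
    finally show ?thesis .
  qed
qed

text \<open>The square of the estimate wanted for the ball, cleared of denominators so that it can
  be proved by induction on the number of variables. A new variable adds
  \<open>k n * mi_deg n l\<close> to the twist, which is the exponent \<open>c * b\<close> in
  \<open>q_vandermonde_summand_le\<close>.\<close>

lemma mi_q_fact_submultiplicative:
  assumes t: "0 < t"
  shows "t ^ q_twist n k l * mi_q_fact n t (\<lambda>i. k i + l i) * (q_fact t (mi_deg n k) * q_fact t (mi_deg n l))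
       \<le> q_fact t (mi_deg n k + mi_deg n l) * (mi_q_fact n t k * mi_q_fact n t l)"
proof (induction n)
  case 0
  then show ?case by (simp add: q_twist_def mi_q_fact_def mi_deg_def)
next
  case (Suc n)
  define F where "F = q_fact t"
  define a b c d where "a = mi_deg n k" and "b = mi_deg n l" and "c = k n" and "d = l n"
  define K L M T where "K = mi_q_fact n t k" and "L = mi_q_fact n t l"
    and "M = mi_q_fact n t (\<lambda>i. k i + l i)" and "T = t ^ q_twist n k l"
  have F: "0 < F m" for m using q_fact_pos[OF t] by (simp add: F_def)
  have KL: "0 < K" "0 < L" unfolding K_def L_def mi_q_fact_def by (auto intro!: prod_pos q_fact_pos t)
  have IH: "T * M * (F a * F b) \<le> F (a + b) * (K * L)"
    using Suc by (simp add: F_def a_def b_def K_def L_def M_def T_def)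
  have V: "t ^ (c * b) * (F (a + b) * F (c + d) * F (a + c) * F (b + d)) \<le> F (a + c + (b + d)) * (F a * F b * F c * F d)"
    using q_vandermonde_summand_le[OF t, of c b a d] F[of a] F[of b] F[of c] F[of d] F[of "a + c"] F[of "b + d"]
    by (simp add: q_binomial_def F_def field_simps)
  have "T * t ^ (c * b) * (M * F (c + d)) * (F (a + c) * F (b + d)) * (F a * F b)
      = (T * M * (F a * F b)) * (t ^ (c * b) * F (c + d) * F (a + c) * F (b + d))"
    by (simp add: ac_simps)
  also have "\<dots> \<le> (F (a + b) * (K * L)) * (t ^ (c * b) * F (c + d) * F (a + c) * F (b + d))"
    using IH t F by (intro mult_right_mono mult_nonneg_nonneg) (auto intro: less_imp_le)
  also have "\<dots> = (K * L) * (t ^ (c * b) * (F (a + b) * F (c + d) * F (a + c) * F (b + d)))"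
    by (simp add: ac_simps)
  also have "\<dots> \<le> (K * L) * (F (a + c + (b + d)) * (F a * F b * F c * F d))"
    using V KL by (intro mult_left_mono) auto
  also have "\<dots> = F (a + c + (b + d)) * (K * F c * (L * F d)) * (F a * F b)"
    by (simp add: ac_simps)
  \<comment> \<open>The positive factor \<open>F a * F b\<close> was carried along only to match the
    induction hypothesis, and is cancelled here.\<close>
  finally have "T * t ^ (c * b) * (M * F (c + d)) * (F (a + c) * F (b + d)) \<le> F (a + c + (b + d)) * (K * F c * (L * F d))"
    by (rule mult_right_le_imp_le) (simp add: F)
  moreover have "mi_deg (Suc n) k = a + c" "mi_deg (Suc n) l = b + d"
    "mi_q_fact (Suc n) t k = K * F c" "mi_q_fact (Suc n) t l = L * F d"
    "mi_q_fact (Suc n) t (\<lambda>i. k i + l i) = M * F (c + d)" "t ^ q_twist (Suc n) k l = T * t ^ (c * b)"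
    by (simp_all add: mi_deg_def mi_q_fact_def a_def b_def c_def d_def K_def L_def M_def F_def T_def
        q_twist_Suc power_add)
  ultimately show ?case by (simp add: F_def)
qed

lemma mi_q_fact_pos: "0 < t \<Longrightarrow> 0 < mi_q_fact n t k"
  unfolding mi_q_fact_def by (intro prod_pos) (auto intro: q_fact_pos)

text \<open>With $t = |q|^{-2}$ the twist factor is itself the square root of
  \<open>t ^ q_twist n k l\<close>, so everything goes under one root and
  \<open>mi_q_fact_submultiplicative\<close> applies.\<close>

lemma ball_weight_submultiplicative:
  assumes "q \<noteq> 0"
  shows "inverse (cmod q) ^ q_twist n k l * ball_weight n q (\<lambda>i. k i + l i)
       \<le> ball_weight n q k * ball_weight n q l"
proof -
  define t where "t = cmod q powi (-2)"
  have t: "0 < t" "t = inverse (cmod q) ^ 2"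
    using assms by (auto simp: t_def power_int_minus power_inverse)
  have "inverse (cmod q) ^ q_twist n k l = sqrt (t ^ q_twist n k l)"
    unfolding t(2) by (simp add: real_sqrt_power)
  moreover have "t ^ q_twist n k l * (mi_q_fact n t (\<lambda>i. k i + l i) / q_fact t (mi_deg n k + mi_deg n l))
      \<le> mi_q_fact n t k / q_fact t (mi_deg n k) * (mi_q_fact n t l / q_fact t (mi_deg n l))"
    using mi_q_fact_submultiplicative[OF t(1), of n k l] q_fact_pos[OF t(1)]
    by (simp add: field_simps)
  ultimately show ?thesis
    unfolding ball_weight_def t_def[symmetric] mi_deg_add by (simp flip: real_sqrt_mult)
qed

lemma ball_weight_pos:
  assumes "q \<noteq> 0"
  shows "0 < ball_weight n q k"
proof -
  have "0 < cmod q powi (-2)" using assms by simp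
  then show ?thesis unfolding ball_weight_def by (simp add: mi_q_fact_pos q_fact_pos)
qed

lemma continuous_on_q_fact [continuous_intros]:
  "continuous_on A f \<Longrightarrow> continuous_on A (\<lambda>x. q_fact (f x) m)"
  unfolding q_fact_def q_int_def by (intro continuous_on_prod continuous_on_sum continuous_on_power)

lemma continuous_on_ball_weight: "continuous_on (UNIV - {0}) (\<lambda>q. ball_weight n q k)"
  unfolding ball_weight_def mi_q_fact_def
proof (intro continuous_intros ballI)
  fix q :: complex assume "q \<in> UNIV - {0}"
  then have "0 < cmod q powi (-2)" by simp
  from q_fact_pos[OF this] show "q_fact (cmod q powi (-2)) (mi_deg n k) \<noteq> 0" by (metis less_irrefl)
qed auto

lemma continuous_on_w_weight: "continuous_on A (\<lambda>q. w_weight n q k)"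
  unfolding w_weight_eq
  by (intro continuous_on_power continuous_on_min continuous_on_const continuous_on_norm_id)

section \<open>Convolutions\<close>

lemma
  fixes f :: "'a \<Rightarrow> real" and g :: "'b \<Rightarrow> real"
  assumes f: "f summable_on A" "\<And>x. x \<in> A \<Longrightarrow> 0 \<le> f x"
    and g: "g summable_on B" "\<And>y. y \<in> B \<Longrightarrow> 0 \<le> g y"
  shows summable_on_product_nonneg: "(\<lambda>(x, y). f x * g y) summable_on A \<times> B"
    and infsum_product_nonneg: "infsum (\<lambda>(x, y). f x * g y) (A \<times> B) = infsum f A * infsum g B"
proof -
  show *: "(\<lambda>(x, y). f x * g y) summable_on A \<times> B"
  proof (rule summable_on_SigmaI[where g = "\<lambda>x. f x * infsum g B"])
    show "((\<lambda>y. case (x, y) of (x, y) \<Rightarrow> f x * g y) has_sum f x * infsum g B) B" for x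
      using has_sum_cmult_right[OF has_sum_infsum[OF g(1)]] by simp
    show "(\<lambda>x. f x * infsum g B) summable_on A"
      by (rule summable_on_cmult_left[OF f(1)])
    show "0 \<le> (case (x, y) of (x, y) \<Rightarrow> f x * g y)" if "x \<in> A" "y \<in> B" for x y
      using f(2)[OF that(1)] g(2)[OF that(2)] by simp
  qed
  have "infsum (\<lambda>(x, y). f x * g y) (A \<times> B) = infsum (\<lambda>x. infsum (\<lambda>y. f x * g y) B) A"
    by (rule infsum_Sigma'_banach[symmetric]) (rule *)
  also have "\<dots> = infsum f A * infsum g B"
    by (simp add: infsum_cmult_right' infsum_cmult_left')
  finally show "infsum (\<lambda>(x, y). f x * g y) (A \<times> B) = infsum f A * infsum g B" .
qed

text \<open>Dominated convergence along an arbitrary filter: off a finite set the majorant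
  contributes at most \<open>e / 2\<close>, and on that set finitely many limits are summed.\<close>

lemma tendsto_infsum_dominated:
  fixes f :: "'a \<Rightarrow> real" and g :: "'b \<Rightarrow> 'a \<Rightarrow> real"
  assumes f: "f summable_on A"
    and bound: "eventually (\<lambda>q. \<forall>x\<in>A. 0 \<le> g q x \<and> g q x \<le> f x) F"
    and lim: "\<And>x. x \<in> A \<Longrightarrow> ((\<lambda>q. g q x) \<longlongrightarrow> 0) F"
  shows "((\<lambda>q. infsum (g q) A) \<longlongrightarrow> 0) F"
proof (rule tendstoI)
  fix e :: real assume e: "0 < e"
  then have "0 < e / 2" by simp
  from infsum_finite_approximation[OF f this]
  obtain K where K: "finite K" "K \<subseteq> A" "dist (sum f K) (infsum f A) \<le> e / 2" by blast
  have fK: "f summable_on K" "f summable_on (A - K)"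
    using K f by (auto intro: summable_on_subset_banach)
  have "infsum f (A - K) = infsum f A - sum f K"
    using infsum_Diff[OF f fK(1) K(2)] K(1) by simp
  with K(3) have tail: "infsum f (A - K) \<le> e / 2" unfolding dist_real_def by linarith
  have "((\<lambda>q. \<Sum>x\<in>K. g q x) \<longlongrightarrow> (\<Sum>x\<in>K. 0)) F"
    using K(2) lim by (intro tendsto_sum) auto
  then have "eventually (\<lambda>q. (\<Sum>x\<in>K. g q x) < e / 2) F"
    using e by (intro order_tendstoD(2)[of _ 0]) simp_all
  with bound show "eventually (\<lambda>q. dist (infsum (g q) A) 0 < e) F"
  proof eventually_elim
    case (elim q)
    have g: "g q summable_on A"
      by (rule summable_on_comparison_test[OF f]) (use elim in simp_all)
    then have gK: "g q summable_on (A - K)" by (rule summable_on_subset_banach) auto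
    have "infsum (g q) (A - K) \<le> infsum f (A - K)"
      by (rule infsum_mono[OF gK fK(2)]) (use elim in simp)
    moreover have "infsum (g q) (A - K) = infsum (g q) A - sum (g q) K"
      using infsum_Diff[OF g _ K(2)] K(1) by simp
    moreover have "0 \<le> infsum (g q) A" by (rule infsum_nonneg) (use elim in simp)
    ultimately show ?case using elim tail by (simp add: dist_real_def)
  qed
qed

text \<open>The two-index family \<open>H\<close> is arbitrary, not a product
  \<open>a k * b l\<close>, so that the difference of two products with different kernels is again
  of this form.\<close>

definition conv :: "nat \<Rightarrow> (multi_index \<Rightarrow> multi_index \<Rightarrow> complex) \<Rightarrow> series" where
  "conv n H m = (if m \<in> multi_indices n then \<Sum>k | \<forall>i. k i \<le> m i. H k (\<lambda>i. m i - k i) else 0)"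

lemma conv_diff: "conv n H m - conv n H' m = conv n (\<lambda>k l. H k l - H' k l) m"
  by (simp add: conv_def sum_subtractf)

text \<open>Grouping the double family by \<open>m = k + l\<close> turns the sum over pairs into a
  sum over \<open>m\<close> of finite inner sums, and each inner sum dominates the term of
  \<open>conv\<close> because the degree is additive. The literal factor 1 is the constant weight,
  kept so that the facts match \<open>series_weight\<close> with that weight.\<close>

lemma
  assumes sum: "(\<lambda>(k, l). cmod (H k l) * (\<rho> ^ mi_deg n k * \<rho> ^ mi_deg n l))
      summable_on multi_indices n \<times> multi_indices n" and \<rho>: "0 < \<rho>"
  shows conv_summable: "(\<lambda>m. cmod (conv n H m) * 1 * \<rho> ^ mi_deg n m) summable_on multi_indices n"
    and conv_norm_le: "series_norm n (\<lambda>_. 1) \<rho> (conv n H) \<le>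
      infsum (\<lambda>(k, l). cmod (H k l) * (\<rho> ^ mi_deg n k * \<rho> ^ mi_deg n l)) (multi_indices n \<times> multi_indices n)"
proof -
  let ?I = "multi_indices n"
  let ?G = "\<lambda>(k, l). cmod (H k l) * (\<rho> ^ mi_deg n k * \<rho> ^ mi_deg n l)"
  let ?P = "Sigma ?I (\<lambda>m. {k. \<forall>i. k i \<le> m i})"
  let ?f = "\<lambda>(m :: multi_index, k :: multi_index). ?G (k, \<lambda>i. m i - k i)"
  have bij: "bij_betw (\<lambda>(m, k). (k, \<lambda>i. m i - k i)) ?P (?I \<times> ?I)"
  proof (rule bij_betwI[where g = "\<lambda>(k, l). (\<lambda>i. k i + l i, k)"])
    show "(\<lambda>(m, k). (k, \<lambda>i. m i - k i)) \<in> ?P \<rightarrow> ?I \<times> ?I"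
      by (auto intro: multi_indices_le)
    show "(\<lambda>(k, l). (\<lambda>i. k i + l i, k)) \<in> ?I \<times> ?I \<rightarrow> ?P"
      by (auto intro: multi_indices_add)
  qed auto
  have f_eq: "?f = (\<lambda>x. ?G ((\<lambda>(m, k). (k, \<lambda>i. m i - k i)) x))"
    by (simp add: fun_eq_iff)
  have fsum: "?f summable_on ?P"
    unfolding f_eq summable_on_reindex_bij_betw[OF bij, of ?G] by (rule sum)
  have finf: "infsum ?f ?P = infsum ?G (?I \<times> ?I)"
    unfolding f_eq by (rule infsum_reindex_bij_betw[OF bij])
  define h where "h m = infsum (\<lambda>k. ?G (k, \<lambda>i. m i - k i)) {k. \<forall>i. k i \<le> m i}" for m :: multi_index
  have hsum: "h summable_on ?I" and hinf: "infsum h ?I = infsum ?G (?I \<times> ?I)"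
    using summable_on_Sigma_banach[of "\<lambda>m k. ?G (k, \<lambda>i. m i - k i)", OF fsum]
      infsum_Sigma'_banach[of "\<lambda>m k. ?G (k, \<lambda>i. m i - k i)", OF fsum] finf
    by (simp_all only: h_def[abs_def])
  have le: "cmod (conv n H m) * 1 * \<rho> ^ mi_deg n m \<le> h m" if m: "m \<in> ?I" for m
  proof -
    have "cmod (conv n H m) * \<rho> ^ mi_deg n m
        \<le> (\<Sum>k | \<forall>i. k i \<le> m i. cmod (H k (\<lambda>i. m i - k i))) * \<rho> ^ mi_deg n m"
      using m \<rho> by (intro mult_right_mono) (auto simp: conv_def intro: norm_sum)
    also have "\<dots> = (\<Sum>k | \<forall>i. k i \<le> m i. ?G (k, \<lambda>i. m i - k i))"
      unfolding sum_distrib_right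
    proof (rule sum.cong[OF refl])
      fix k assume "k \<in> {k. \<forall>i. k i \<le> m i}"
      then have "mi_deg n m = mi_deg n k + mi_deg n (\<lambda>i. m i - k i)"
        unfolding mi_deg_add[symmetric] by simp
      then show "cmod (H k (\<lambda>i. m i - k i)) * \<rho> ^ mi_deg n m = ?G (k, \<lambda>i. m i - k i)"
        by (simp add: power_add)
    qed
    also have "\<dots> = h m" using finite_le_multi_index[OF m] by (simp add: h_def)
    finally show ?thesis by simp
  qed
  show csum: "(\<lambda>m. cmod (conv n H m) * 1 * \<rho> ^ mi_deg n m) summable_on ?I"
    by (rule summable_on_comparison_test[OF hsum le]) (use \<rho> in simp_all)
  show "series_norm n (\<lambda>_. 1) \<rho> (conv n H) \<le> infsum ?G (?I \<times> ?I)"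
    unfolding series_norm_def hinf[symmetric] by (rule infsum_mono[OF csum hsum le])
qed

section \<open>Algebraic properties of the multiplication\<close>

lemma q_mult_add_left: "q_mult n q (\<lambda>k. a k + b k) c = (\<lambda>m. q_mult n q a c m + q_mult n q b c m)"
  by (auto simp: q_mult_def fun_eq_iff distrib_right sum.distrib)

lemma q_mult_add_right: "q_mult n q a (\<lambda>k. b k + c k) = (\<lambda>m. q_mult n q a b m + q_mult n q a c m)"
  by (auto simp: q_mult_def fun_eq_iff distrib_right distrib_left sum.distrib)

lemma q_mult_scale_left: "q_mult n q (\<lambda>k. z * a k) b = (\<lambda>m. z * q_mult n q a b m)"
  by (auto simp: q_mult_def fun_eq_iff sum_distrib_left mult.assoc)

lemma q_mult_scale_right: "q_mult n q a (\<lambda>k. z * b k) = (\<lambda>m. z * q_mult n q a b m)"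
  by (auto simp: q_mult_def fun_eq_iff sum_distrib_left mult_ac)

lemma q_mult_one_left:
  assumes "\<And>k. k \<notin> multi_indices n \<Longrightarrow> a k = 0"
  shows "q_mult n q (x_pow (\<lambda>i. 0)) a = a"
proof
  fix m show "q_mult n q (x_pow (\<lambda>i. 0)) a m = a m"
  proof (cases "m \<in> multi_indices n")
    case True
    have "q_mult n q (x_pow (\<lambda>i. 0)) a m = (\<Sum>k | \<forall>i. k i \<le> m i. if k = (\<lambda>i. 0) then a m else 0)"
      using True unfolding q_mult_def by (simp only: if_True) (rule sum.cong, auto simp: x_pow_def)
    also have "\<dots> = a m" using finite_le_multi_index[OF True] by (simp add: sum.delta)
    finally show ?thesis .
  qed (use assms in \<open>simp add: q_mult_def\<close>)
qed

lemma q_mult_one_right: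
  assumes "\<And>k. k \<notin> multi_indices n \<Longrightarrow> a k = 0"
  shows "q_mult n q a (x_pow (\<lambda>i. 0)) = a"
proof
  fix m show "q_mult n q a (x_pow (\<lambda>i. 0)) m = a m"
  proof (cases "m \<in> multi_indices n")
    case True
    have diff: "(\<lambda>i. m i - k i) = (\<lambda>i. 0) \<longleftrightarrow> k = m" if "\<forall>i. k i \<le> m i" for k
      using that by (auto simp: fun_eq_iff intro: le_antisym)
    have "q_mult n q a (x_pow (\<lambda>i. 0)) m = (\<Sum>k | \<forall>i. k i \<le> m i. if k = m then a m else 0)"
      using True unfolding q_mult_def
      by (simp only: if_True) (rule sum.cong, auto simp: x_pow_def diff)
    also have "\<dots> = a m" using finite_le_multi_index[OF True] by (simp add: sum.delta)
    finally show ?thesis .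
  qed (use assms in \<open>simp add: q_mult_def\<close>)
qed

text \<open>Both sides are sums over the decompositions of \<open>m\<close> into three
  multi-indices. The summands agree since the twist is biadditive, hence a 2-cocycle.\<close>

lemma q_mult_assoc: "q_mult n q (q_mult n q a b) c = q_mult n q a (q_mult n q b c)"
proof
  fix m show "q_mult n q (q_mult n q a b) c m = q_mult n q a (q_mult n q b c) m"
  proof (cases "m \<in> multi_indices n")
    case m: True
    let ?L = "\<lambda>m :: multi_index. {k :: multi_index. \<forall>i. k i \<le> m i}"
    let ?t = "\<lambda>k l. inverse q ^ q_twist n k l"
    have L: "k \<in> multi_indices n" "(\<lambda>i. m i - k i) \<in> multi_indices n" if "k \<in> ?L m" for k
      using that by (auto intro: multi_indices_le[OF m])
    have expand: "q_mult n q x y k = (\<Sum>j\<in>?L k. x j * y (\<lambda>i. k i - j i) * ?t j (\<lambda>i. k i - j i))"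
      if "k \<in> multi_indices n" for x y k
      using that by (simp add: q_mult_def)
    have "q_mult n q (q_mult n q a b) c m
        = (\<Sum>k\<in>?L m. \<Sum>j\<in>?L k. a j * b (\<lambda>i. k i - j i) * c (\<lambda>i. m i - k i) *
            (?t j (\<lambda>i. k i - j i) * ?t k (\<lambda>i. m i - k i)))"
      unfolding expand[OF m]
      by (rule sum.cong[OF refl]) (simp only: expand[OF L(1)] sum_distrib_left sum_distrib_right mult_ac)
    also have "\<dots> = (\<Sum>(k, j)\<in>Sigma (?L m) ?L. a j * b (\<lambda>i. k i - j i) * c (\<lambda>i. m i - k i) *
            (?t j (\<lambda>i. k i - j i) * ?t k (\<lambda>i. m i - k i)))"
      using finite_le_multi_index[OF m] finite_le_multi_index[OF L(1)] by (intro sum.Sigma) auto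
    also have "\<dots> = (\<Sum>(j, p)\<in>Sigma (?L m) (\<lambda>j. ?L (\<lambda>i. m i - j i)).
        a j * b p * c (\<lambda>i. m i - j i - p i) *
            (?t p (\<lambda>i. m i - j i - p i) * ?t j (\<lambda>i. m i - j i)))"
    proof (rule sum.reindex_bij_witness[where j = "\<lambda>(k, j). (j, \<lambda>i. k i - j i)" and i = "\<lambda>(j, p). (\<lambda>i. j i + p i, j)"])
      fix x assume "x \<in> Sigma (?L m) ?L"
      then obtain k j where x: "x = (k, j)" and le: "\<And>i. k i \<le> m i" "\<And>i. j i \<le> k i" by auto
      define p where "p i = k i - j i" for i
      define s where "s i = m i - k i" for i
      \<comment> \<open>Writing \<open>k\<close> and \<open>m\<close> as sums lets the simplifier
        remove every truncated subtraction.\<close>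
      have eqs: "k = (\<lambda>i. j i + p i)" "m = (\<lambda>i. j i + (p i + s i))"
        using le order_trans[OF le(2) le(1)] by (simp_all add: p_def s_def fun_eq_iff)
      show "(case x of (k, j) \<Rightarrow> (j, \<lambda>i. k i - j i)) \<in> Sigma (?L m) (\<lambda>j. ?L (\<lambda>i. m i - j i))"
        by (simp add: x eqs)
      show "(case (case x of (k, j) \<Rightarrow> (j, \<lambda>i. k i - j i)) of (j, p) \<Rightarrow> (\<lambda>i. j i + p i, j)) = x"
        by (simp add: x eqs)
      \<comment> \<open>The cocycle identity: both exponents equal the sum of the twists of
        \<open>(j, p)\<close>, \<open>(j, s)\<close> and \<open>(p, s)\<close>.\<close>
      have "?t j p * ?t k s = ?t p s * ?t j (\<lambda>i. p i + s i)"
        unfolding eqs(1) q_twist_add_left q_twist_add_right power_add by (simp only: mult_ac)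
      then show "(case (case x of (k, j) \<Rightarrow> (j, \<lambda>i. k i - j i)) of (j, p) \<Rightarrow>
          a j * b p * c (\<lambda>i. m i - j i - p i) * (?t p (\<lambda>i. m i - j i - p i) * ?t j (\<lambda>i. m i - j i)))
        = (case x of (k, j) \<Rightarrow> a j * b (\<lambda>i. k i - j i) * c (\<lambda>i. m i - k i) *
            (?t j (\<lambda>i. k i - j i) * ?t k (\<lambda>i. m i - k i)))"
        by (simp add: x eqs)
    next
      fix y assume "y \<in> Sigma (?L m) (\<lambda>j. ?L (\<lambda>i. m i - j i))"
      then obtain j p where y: "y = (j, p)" and le: "\<And>i. j i \<le> m i" "\<And>i. p i \<le> m i - j i" by auto
      have "j i + p i \<le> m i" for i using le(1)[of i] le(2)[of i] by linarith
      then show "(case y of (j, p) \<Rightarrow> (\<lambda>i. j i + p i, j)) \<in> Sigma (?L m) ?L"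
        by (simp add: y)
      show "(case (case y of (j, p) \<Rightarrow> (\<lambda>i. j i + p i, j)) of (k, j) \<Rightarrow> (j, \<lambda>i. k i - j i)) = y"
        by (simp add: y)
    qed
    also have "\<dots> = (\<Sum>j\<in>?L m. \<Sum>p\<in>?L (\<lambda>i. m i - j i). a j * b p * c (\<lambda>i. m i - j i - p i) *
            (?t p (\<lambda>i. m i - j i - p i) * ?t j (\<lambda>i. m i - j i)))"
      using finite_le_multi_index[OF m] finite_le_multi_index[OF L(2)] by (intro sum.Sigma[symmetric]) auto
    also have "\<dots> = q_mult n q a (q_mult n q b c) m"
      unfolding expand[OF m]
      by (rule sum.cong[OF refl]) (simp only: expand[OF L(2)] sum_distrib_left sum_distrib_right mult_ac)
    finally show ?thesis .
  qed (simp add: q_mult_def)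
qed

section \<open>Fibers of bundles\<close>

lemma fiber_simps [simp]:
  "carrier (fiber E x) = fiber_set E x" "monoid.mult (fiber E x) = bmult E"
  "one (fiber E x) = bone E x" "ring.zero (fiber E x) = bzero E x" "add (fiber E x) = badd E"
  "smult (fiber E x) = bscale E" "topol (fiber E x) = subtopology (total E) (fiber_set E x)"
  by (simp_all add: fiber_def)

lemma C_ring_simps [simp]:
  "carrier C_ring = UNIV" "monoid.mult C_ring = (*)" "one C_ring = 1" "ring.zero C_ring = 0"
  "add C_ring = (+)"
  by (simp_all add: C_ring_def)

lemma cring_C_ring: "cring C_ring"
proof (rule cringI)
  show "abelian_group C_ring"
    by (rule abelian_groupI) (auto intro: exI[of _ "- x" for x])
  show "comm_monoid C_ring"
    by (rule comm_monoidI) auto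
qed (auto simp: distrib_right)

lemma topspace_fiber: "topspace (subtopology (total E) (fiber_set E x)) = fiber_set E x"
  by (auto simp: fiber_set_def)

text \<open>The square of a fiber is a subspace of the fiber product, so continuity of a bundle
  operation restricts to each fiber.\<close>

lemma continuous_map_fiber_binary:
  assumes "continuous_map (fiber_product E) (total E) (\<lambda>(u, v). f u v)"
    and "\<And>u v. u \<in> fiber_set E x \<Longrightarrow> v \<in> fiber_set E x \<Longrightarrow> f u v \<in> fiber_set E x"
  shows "continuous_map (prod_topology (topol (fiber E x)) (topol (fiber E x))) (topol (fiber E x))
      (\<lambda>(u, v). f u v)"
proof -
  let ?A = "fiber_set E x"
  have "prod_topology (topol (fiber E x)) (topol (fiber E x))
      = subtopology (prod_topology (total E) (total E)) (?A \<times> ?A)"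
    by (simp add: subtopology_Times)
  also have "?A \<times> ?A = {(u, v). proj E u = proj E v} \<inter> ?A \<times> ?A"
    by (auto simp: fiber_set_def)
  also have "subtopology (prod_topology (total E) (total E)) \<dots> = subtopology (fiber_product E) (?A \<times> ?A)"
    unfolding fiber_product_def subtopology_subtopology ..
  finally have top: "prod_topology (topol (fiber E x)) (topol (fiber E x)) = subtopology (fiber_product E) (?A \<times> ?A)" .
  have "continuous_map (subtopology (fiber_product E) (?A \<times> ?A)) (subtopology (total E) ?A) (\<lambda>(u, v). f u v)"
    using assms(2)
    by (intro continuous_map_into_subtopology continuous_map_from_subtopology assms(1)) auto
  then show ?thesis unfolding top by (simp only: fiber_simps)
qed

lemma continuous_map_fiber_scale:
  assumes "continuous_map (prod_topology euclidean (total E)) (total E) (\<lambda>(c, u). bscale E c u)"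
    and "\<And>c u. u \<in> fiber_set E x \<Longrightarrow> bscale E c u \<in> fiber_set E x"
  shows "continuous_map (prod_topology euclidean (topol (fiber E x))) (topol (fiber E x))
      (\<lambda>(c, u). bscale E c u)"
  unfolding fiber_simps prod_topology_subtopology
  using assms(2)
  by (intro continuous_map_into_subtopology continuous_map_from_subtopology assms(1)) auto

section \<open>The rescaled bundle\<close>

text \<open>The common ground of the two weights. Submultiplicativity with the twist factor is the
  bound 1 on the kernel in cleared form, and the normalization at 0 makes the rescaling fix the
  unit.\<close>

locale weight_family =
  fixes n :: nat and r :: ereal and w :: "complex \<Rightarrow> multi_index \<Rightarrow> real"
  assumes family_radius_pos: "0 < r"
    and family_pos: "\<And>q k. q \<noteq> 0 \<Longrightarrow> k \<in> multi_indices n \<Longrightarrow> 0 < w q k"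
    and family_one: "\<And>q. q \<noteq> 0 \<Longrightarrow> w q (\<lambda>i. 0) = 1"
    and family_continuous: "\<And>k. k \<in> multi_indices n \<Longrightarrow> continuous_on (UNIV - {0}) (\<lambda>q. w q k)"
    and family_submultiplicative:
      "\<And>q k l. q \<noteq> 0 \<Longrightarrow> k \<in> multi_indices n \<Longrightarrow> l \<in> multi_indices n \<Longrightarrow>
        inverse (cmod q) ^ q_twist n k l * w q (\<lambda>i. k i + l i) \<le> w q k * w q l"
begin

text \<open>From here on unqualified \<open>S\<close>, \<open>snorm\<close> and \<open>sball\<close>
  refer to the model fiber with constant weight; the weight \<open>w q\<close> itself is interpreted
  only in \<open>topalg_iso_fiber\<close>.\<close>

sublocale series_weight n "\<lambda>_. 1" r
  by unfold_locales (simp_all add: family_radius_pos)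

abbreviation X :: "complex topology" where "X \<equiv> top_of_set (UNIV - {0})"

text \<open>
  \<open>up q\<close> is an isomorphism from the fiber algebra over \<open>q\<close>, with its weight \<open>w q\<close>, onto the common
  unweighted space; \<open>down q\<close> is its inverse, and \<open>mult q\<close> the transported multiplication.
\<close>

definition down :: "complex \<Rightarrow> series \<Rightarrow> series" where
  "down q a = (\<lambda>k. a k / of_real (w q k))"

definition up :: "complex \<Rightarrow> series \<Rightarrow> series" where
  "up q a = (\<lambda>k. of_real (w q k) * a k)"

definition mult :: "complex \<Rightarrow> series \<Rightarrow> series \<Rightarrow> series" where
  "mult q a b = up q (q_mult n q (down q a) (down q b))"

definition kernel :: "complex \<Rightarrow> multi_index \<Rightarrow> multi_index \<Rightarrow> complex" where
  "kernel q k l = inverse q ^ q_twist n k l * of_real (w q (\<lambda>i. k i + l i) / (w q k * w q l))"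

lemma mult_eq_conv:
  assumes "q \<noteq> 0"
  shows "mult q a b = conv n (\<lambda>k l. a k * b l * kernel q k l)"
proof
  fix m
  show "mult q a b m = conv n (\<lambda>k l. a k * b l * kernel q k l) m"
  proof (cases "m \<in> multi_indices n")
    case True
    have "of_real (w q m) * (\<Sum>k | \<forall>i. k i \<le> m i. (a k / of_real (w q k)) *
          (b (\<lambda>i. m i - k i) / of_real (w q (\<lambda>i. m i - k i))) * inverse q ^ q_twist n k (\<lambda>i. m i - k i))
        = (\<Sum>k | \<forall>i. k i \<le> m i. a k * b (\<lambda>i. m i - k i) * kernel q k (\<lambda>i. m i - k i))"
      unfolding sum_distrib_left
    proof (rule sum.cong[OF refl])
      fix k assume "k \<in> {k. \<forall>i. k i \<le> m i}"
      then have "(\<lambda>i. k i + (m i - k i)) = m" by auto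
      then show "of_real (w q m) * ((a k / of_real (w q k)) *
          (b (\<lambda>i. m i - k i) / of_real (w q (\<lambda>i. m i - k i))) * inverse q ^ q_twist n k (\<lambda>i. m i - k i))
        = a k * b (\<lambda>i. m i - k i) * kernel q k (\<lambda>i. m i - k i)"
        by (simp add: kernel_def)
    qed
    with True show ?thesis by (simp add: mult_def up_def down_def q_mult_def conv_def)
  qed (simp add: mult_def up_def q_mult_def conv_def)
qed

section \<open>Estimates for the kernel and the transported multiplication\<close>

lemma cmod_kernel_le_1:
  assumes "q \<noteq> 0" "k \<in> multi_indices n" "l \<in> multi_indices n"
  shows "cmod (kernel q k l) \<le> 1"
proof -
  note pos = family_pos[OF assms(1,2)] family_pos[OF assms(1,3)]
    family_pos[OF assms(1) multi_indices_add[OF assms(2,3)]]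
  have "cmod (kernel q k l)
      = inverse (cmod q) ^ q_twist n k l * w q (\<lambda>i. k i + l i) / (w q k * w q l)"
    using pos by (simp add: kernel_def norm_mult norm_power norm_inverse norm_divide)
  also have "\<dots> \<le> 1" using family_submultiplicative[OF assms] pos by simp
  finally show ?thesis .
qed

lemma tendsto_kernel:
  assumes "q \<noteq> 0" "k \<in> multi_indices n" "l \<in> multi_indices n"
  shows "((\<lambda>p. kernel p k l) \<longlongrightarrow> kernel q k l) (nhds q)"
proof -
  have w: "((\<lambda>p. w p j) \<longlongrightarrow> w q j) (nhds q)" if "j \<in> multi_indices n" for j
  proof -
    have "open (UNIV - {0 :: complex})" by (intro open_Diff) auto
    with family_continuous[OF that] assms(1) have "isCont (\<lambda>p. w p j) q"
      by (simp add: continuous_on_eq_continuous_at)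
    then show ?thesis
      unfolding isCont_def using tendsto_at_iff_tendsto_nhds[of "\<lambda>p. w p j" q] by simp
  qed
  note pos = family_pos[OF assms(1,2)] family_pos[OF assms(1,3)]
  show ?thesis
    unfolding kernel_def
    using assms pos by (intro tendsto_intros w multi_indices_add filterlim_ident) auto
qed

lemma product_summable:
  assumes "a \<in> S" "b \<in> S" "radius \<rho>"
  shows "(\<lambda>(k, l). cmod (a k) * cmod (b l) * (\<rho> ^ mi_deg n k * \<rho> ^ mi_deg n l))
      summable_on multi_indices n \<times> multi_indices n"
    and "infsum (\<lambda>(k, l). cmod (a k) * cmod (b l) * (\<rho> ^ mi_deg n k * \<rho> ^ mi_deg n l))
      (multi_indices n \<times> multi_indices n) = snorm \<rho> a * snorm \<rho> b"
proof -
  have eq: "(\<lambda>(k, l). cmod (a k) * cmod (b l) * (\<rho> ^ mi_deg n k * \<rho> ^ mi_deg n l))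
      = (\<lambda>(k, l). (cmod (a k) * 1 * \<rho> ^ mi_deg n k) * (cmod (b l) * 1 * \<rho> ^ mi_deg n l))"
    by (simp add: fun_eq_iff)
  have nonneg: "0 \<le> cmod (c k) * 1 * \<rho> ^ mi_deg n k" for c :: series and k
    using assms(3) by simp
  show "(\<lambda>(k, l). cmod (a k) * cmod (b l) * (\<rho> ^ mi_deg n k * \<rho> ^ mi_deg n l))
      summable_on multi_indices n \<times> multi_indices n"
    unfolding eq
    by (intro summable_on_product_nonneg space_summable assms nonneg)
  show "infsum (\<lambda>(k, l). cmod (a k) * cmod (b l) * (\<rho> ^ mi_deg n k * \<rho> ^ mi_deg n l))
      (multi_indices n \<times> multi_indices n) = snorm \<rho> a * snorm \<rho> b"
    unfolding eq series_norm_def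
    by (rule infsum_product_nonneg[where f = "\<lambda>k. cmod (a k) * 1 * \<rho> ^ mi_deg n k"
          and g = "\<lambda>l. cmod (b l) * 1 * \<rho> ^ mi_deg n l"]; intro space_summable assms nonneg)
qed

text \<open>As the kernel is bounded by 1, the double series is dominated by the product of the two
  norm series.\<close>

lemma mult_closed:
  assumes "q \<noteq> 0" "a \<in> S" "b \<in> S"
  shows "mult q a b \<in> S"
proof -
  have "(\<lambda>m. cmod (mult q a b m) * 1 * \<rho> ^ mi_deg n m) summable_on multi_indices n" if \<rho>: "radius \<rho>" for \<rho>
    unfolding mult_eq_conv[OF assms(1)]
  proof (rule conv_summable[OF summable_on_comparison_test[OF product_summable(1)[OF assms(2,3) \<rho>]]])
    fix x assume "x \<in> multi_indices n \<times> multi_indices n"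
    then obtain k l where x: "x = (k, l)" and kl: "k \<in> multi_indices n" "l \<in> multi_indices n" by blast
    have "cmod (a k) * cmod (b l) * cmod (kernel q k l) \<le> cmod (a k) * cmod (b l)"
      using cmod_kernel_le_1[OF assms(1) kl] by (simp add: mult_left_le)
    then show "(case x of (k, l) \<Rightarrow> cmod (a k * b l * kernel q k l) * (\<rho> ^ mi_deg n k * \<rho> ^ mi_deg n l))
        \<le> (case x of (k, l) \<Rightarrow> cmod (a k) * cmod (b l) * (\<rho> ^ mi_deg n k * \<rho> ^ mi_deg n l))"
      using \<rho> by (simp add: x norm_mult mult_right_mono)
    show "0 \<le> (case x of (k, l) \<Rightarrow> cmod (a k * b l * kernel q k l) * (\<rho> ^ mi_deg n k * \<rho> ^ mi_deg n l))"
      using \<rho> by (simp add: x)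
  qed (use \<rho> in simp)
  moreover have "mult q a b k = 0" if "k \<notin> multi_indices n" for k
    using that by (simp add: mult_eq_conv[OF assms(1)] conv_def)
  ultimately show ?thesis by (simp add: series_space_def)
qed

text \<open>The part of the variation of \<open>mult\<close> that comes from the change of the base point.\<close>

definition defect :: "real \<Rightarrow> complex \<Rightarrow> series \<Rightarrow> series \<Rightarrow> complex \<Rightarrow> real" where
  "defect \<rho> p a b q = infsum (\<lambda>(k, l). cmod (a k) * cmod (b l) * (\<rho> ^ mi_deg n k * \<rho> ^ mi_deg n l) *
     cmod (kernel q k l - kernel p k l)) (multi_indices n \<times> multi_indices n)"

lemma cmod_kernel_diff_le_2:
  assumes "p \<noteq> 0" "q \<noteq> 0" "k \<in> multi_indices n" "l \<in> multi_indices n"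
  shows "cmod (kernel q k l - kernel p k l) \<le> 2"
  using norm_triangle_ineq4[of "kernel q k l" "kernel p k l"]
    cmod_kernel_le_1[OF assms(1,3,4)] cmod_kernel_le_1[OF assms(2,3,4)] by linarith

lemma defect_term_le:
  assumes "radius \<rho>" "p \<noteq> 0" "q \<noteq> 0" "x \<in> multi_indices n \<times> multi_indices n"
  shows "(case x of (k, l) \<Rightarrow> cmod (a k) * cmod (b l) * (\<rho> ^ mi_deg n k * \<rho> ^ mi_deg n l) *
      cmod (kernel q k l - kernel p k l)) \<le>
    (case x of (k, l) \<Rightarrow> cmod (a k) * cmod (b l) * (\<rho> ^ mi_deg n k * \<rho> ^ mi_deg n l)) * 2"
proof -
  obtain k l where x: "x = (k, l)" and kl: "k \<in> multi_indices n" "l \<in> multi_indices n"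
    using assms(4) by blast
  show ?thesis
    unfolding x prod.case
    using cmod_kernel_diff_le_2[OF assms(2,3) kl] assms(1) by (intro mult_left_mono) auto
qed

lemma defect_summable:
  assumes "radius \<rho>" "p \<noteq> 0" "q \<noteq> 0" "a \<in> S" "b \<in> S"
  shows "(\<lambda>(k, l). cmod (a k) * cmod (b l) * (\<rho> ^ mi_deg n k * \<rho> ^ mi_deg n l) *
     cmod (kernel q k l - kernel p k l)) summable_on multi_indices n \<times> multi_indices n"
proof (rule summable_on_comparison_test[OF summable_on_cmult_left[OF product_summable(1)[OF assms(4,5,1)]]])
  show "0 \<le> (case x of (k, l) \<Rightarrow> cmod (a k) * cmod (b l) * (\<rho> ^ mi_deg n k * \<rho> ^ mi_deg n l) *
     cmod (kernel q k l - kernel p k l))" for x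
    using assms(1) by (cases x) simp
qed (rule defect_term_le[OF assms(1-3)])

text \<open>Each term tends to 0 by \<open>tendsto_kernel\<close>. The majorant is twice the product
  of the two norm series, available because the pair \<open>(a, b)\<close> does not move with
  \<open>q\<close>.\<close>

lemma defect_tendsto_0:
  assumes "radius \<rho>" "p \<noteq> 0" "a \<in> S" "b \<in> S"
  shows "(defect \<rho> p a b \<longlongrightarrow> 0) (nhds p)"
  unfolding defect_def[abs_def]
proof (rule tendsto_infsum_dominated[OF summable_on_cmult_left[OF product_summable(1)[OF assms(3,4,1)], where c = 2]])
  have "eventually (\<lambda>q. q \<noteq> 0) (nhds p)"
    using eventually_nhds_in_open[of "UNIV - {0}" p] assms(2) by (simp add: open_Diff)
  then show "eventually (\<lambda>q. \<forall>x\<in>multi_indices n \<times> multi_indices n.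
      0 \<le> (case x of (k, l) \<Rightarrow> cmod (a k) * cmod (b l) * (\<rho> ^ mi_deg n k * \<rho> ^ mi_deg n l) *
        cmod (kernel q k l - kernel p k l)) \<and>
      (case x of (k, l) \<Rightarrow> cmod (a k) * cmod (b l) * (\<rho> ^ mi_deg n k * \<rho> ^ mi_deg n l) *
        cmod (kernel q k l - kernel p k l)) \<le>
      (case x of (k, l) \<Rightarrow> cmod (a k) * cmod (b l) * (\<rho> ^ mi_deg n k * \<rho> ^ mi_deg n l)) * 2) (nhds p)"
  proof eventually_elim
    case (elim q)
    show ?case
    proof (intro ballI conjI)
      fix x assume "x \<in> multi_indices n \<times> multi_indices n"
      from defect_term_le[OF assms(1,2) elim this] show
        "(case x of (k, l) \<Rightarrow> cmod (a k) * cmod (b l) * (\<rho> ^ mi_deg n k * \<rho> ^ mi_deg n l) *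
          cmod (kernel q k l - kernel p k l)) \<le>
        (case x of (k, l) \<Rightarrow> cmod (a k) * cmod (b l) * (\<rho> ^ mi_deg n k * \<rho> ^ mi_deg n l)) * 2" .
    qed (use assms(1) in auto)
  qed
  fix x assume "x \<in> multi_indices n \<times> multi_indices n"
  then obtain k l where x: "x = (k, l)" and kl: "k \<in> multi_indices n" "l \<in> multi_indices n" by blast
  have "((\<lambda>q. cmod (kernel q k l - kernel p k l)) \<longlongrightarrow> 0) (nhds p)"
    by (rule tendsto_norm_zero[OF LIM_zero[OF tendsto_kernel[OF assms(2) kl]]])
  then show "((\<lambda>q. case x of (k, l) \<Rightarrow> cmod (a k) * cmod (b l) * (\<rho> ^ mi_deg n k * \<rho> ^ mi_deg n l) *
        cmod (kernel q k l - kernel p k l)) \<longlongrightarrow> 0) (nhds p)"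
    unfolding x prod.case by (rule tendsto_mult_right_zero)
qed

text \<open>One of the left factor, the right factor and the kernel is changed at a time. The order
  matters: the kernel is changed last, with \<open>a\<close> and \<open>b\<close> already in place,
  so \<open>a'\<close> and \<open>b'\<close> never meet a difference of kernels.\<close>

lemma mult_diff_le:
  assumes "radius \<rho>" "p \<noteq> 0" "q \<noteq> 0" "a \<in> S" "b \<in> S" "a' \<in> S" "b' \<in> S"
  shows "snorm \<rho> (\<lambda>m. mult q a' b' m - mult p a b m) \<le>
    snorm \<rho> (\<lambda>k. a' k - a k) * snorm \<rho> b' + snorm \<rho> a * snorm \<rho> (\<lambda>k. b' k - b k) + defect \<rho> p a b q"
proof -
  let ?I = "multi_indices n \<times> multi_indices n"
  let ?r = "\<lambda>k l. \<rho> ^ mi_deg n k * \<rho> ^ mi_deg n l"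
  let ?f = "\<lambda>(k, l). cmod (a' k - a k) * cmod (b' l) * ?r k l"
  let ?g = "\<lambda>(k, l). cmod (a k) * cmod (b' l - b l) * ?r k l"
  let ?h = "\<lambda>(k, l). cmod (a k) * cmod (b l) * ?r k l * cmod (kernel q k l - kernel p k l)"
  let ?H = "\<lambda>k l. a' k * b' l * kernel q k l - a k * b l * kernel p k l"
  note f = product_summable(1)[OF space_diff[OF assms(6,4)] assms(7,1)]
  note g = product_summable(1)[OF assms(4) space_diff[OF assms(7,5)] assms(1)]
  note h = defect_summable[OF assms(1-5)]
  note fgh = summable_on_add[OF summable_on_add[OF f g] h]
  have le: "(case x of (k, l) \<Rightarrow> cmod (?H k l) * ?r k l) \<le> ?f x + ?g x + ?h x" if xI: "x \<in> ?I" for x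
  proof -
    obtain k l where x: "x = (k, l)" and kl: "k \<in> multi_indices n" "l \<in> multi_indices n"
      using xI by blast
    have split: "?H k l = (a' k - a k) * b' l * kernel q k l + a k * (b' l - b l) * kernel q k l
        + a k * b l * (kernel q k l - kernel p k l)"
      by (simp add: algebra_simps)
    have "cmod (?H k l) \<le> cmod ((a' k - a k) * b' l * kernel q k l) + cmod (a k * (b' l - b l) * kernel q k l)
        + cmod (a k * b l * (kernel q k l - kernel p k l))"
      unfolding split by (intro order_trans[OF norm_triangle_ineq] add_right_mono norm_triangle_ineq)
    also have "\<dots> \<le> cmod (a' k - a k) * cmod (b' l) + cmod (a k) * cmod (b' l - b l)
        + cmod (a k) * cmod (b l) * cmod (kernel q k l - kernel p k l)"
      using cmod_kernel_le_1[OF assms(3) kl] by (simp add: norm_mult add_mono mult_left_le)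
    finally have "cmod (?H k l) * ?r k l \<le> (cmod (a' k - a k) * cmod (b' l) + cmod (a k) * cmod (b' l - b l)
        + cmod (a k) * cmod (b l) * cmod (kernel q k l - kernel p k l)) * ?r k l"
      using assms(1) by (intro mult_right_mono) auto
    then show ?thesis unfolding x prod.case by (simp add: algebra_simps)
  qed
  have nonneg: "0 \<le> (case x of (k, l) \<Rightarrow> cmod (?H k l) * ?r k l)" for x
    using assms(1) by (cases x) simp
  have Hs: "(\<lambda>(k, l). cmod (?H k l) * ?r k l) summable_on ?I"
    by (rule summable_on_comparison_test[OF fgh le nonneg])
  have "snorm \<rho> (\<lambda>m. mult q a' b' m - mult p a b m) = snorm \<rho> (conv n ?H)"
    unfolding mult_eq_conv[OF assms(2)] mult_eq_conv[OF assms(3)] conv_diff ..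
  also have "\<dots> \<le> infsum (\<lambda>(k, l). cmod (?H k l) * ?r k l) ?I"
    by (rule conv_norm_le[OF Hs]) (use assms(1) in simp)
  also have "\<dots> \<le> infsum (\<lambda>x. ?f x + ?g x + ?h x) ?I"
    by (rule infsum_mono[OF Hs fgh le])
  also have "\<dots> = infsum ?f ?I + infsum ?g ?I + infsum ?h ?I"
    unfolding infsum_add[OF summable_on_add[OF f g] h] infsum_add[OF f g] ..
  also have "\<dots> = snorm \<rho> (\<lambda>k. a' k - a k) * snorm \<rho> b' + snorm \<rho> a * snorm \<rho> (\<lambda>k. b' k - b k) + defect \<rho> p a b q"
    unfolding product_summable(2)[OF space_diff[OF assms(6,4)] assms(7,1)]
      product_summable(2)[OF assms(4) space_diff[OF assms(7,5)] assms(1)] defect_def ..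
  finally show ?thesis .
qed

section \<open>Algebra laws transported from \<open>q_mult\<close>\<close>

lemma down_up:
  assumes "q \<noteq> 0" "\<And>k. k \<notin> multi_indices n \<Longrightarrow> a k = 0"
  shows "down q (up q a) = a"
proof
  fix k show "down q (up q a) k = a k"
    using assms family_pos[of q k] by (cases "k \<in> multi_indices n") (auto simp: down_def up_def)
qed

lemma up_down:
  assumes "q \<noteq> 0" "\<And>k. k \<notin> multi_indices n \<Longrightarrow> a k = 0"
  shows "up q (down q a) = a"
proof
  fix k show "up q (down q a) k = a k"
    using assms family_pos[of q k] by (cases "k \<in> multi_indices n") (auto simp: down_def up_def)
qed

lemma space_support: "a \<in> S \<Longrightarrow> k \<notin> multi_indices n \<Longrightarrow> a k = 0"
  by (simp add: series_space_def)

lemma down_mult: "q \<noteq> 0 \<Longrightarrow> down q (mult q a b) = q_mult n q (down q a) (down q b)"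
  unfolding mult_def by (rule down_up) (simp_all add: q_mult_def)

lemma down_add: "down q (\<lambda>k. a k + b k) = (\<lambda>k. down q a k + down q b k)"
  by (simp add: down_def add_divide_distrib)

lemma down_scale: "down q (\<lambda>k. c * a k) = (\<lambda>k. c * down q a k)"
  by (simp add: down_def)

lemma down_one: "q \<noteq> 0 \<Longrightarrow> down q (x_pow (\<lambda>i. 0)) = x_pow (\<lambda>i. 0)"
  by (auto simp: down_def x_pow_def family_one)

lemma up_add: "up q (\<lambda>k. a k + b k) = (\<lambda>k. up q a k + up q b k)"
  by (simp add: up_def distrib_left)

lemma up_scale: "up q (\<lambda>k. c * a k) = (\<lambda>k. c * up q a k)"
  by (simp add: up_def mult_ac)

lemma mult_assoc:
  assumes "q \<noteq> 0"
  shows "mult q (mult q a b) c = mult q a (mult q b c)"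
  unfolding mult_def[of q "mult q a b"] mult_def[of q a "mult q b c"]
    down_mult[OF assms] q_mult_assoc ..

lemma mult_add_left: "mult q (\<lambda>k. a k + b k) c = (\<lambda>k. mult q a c k + mult q b c k)"
  unfolding mult_def down_add q_mult_add_left up_add ..

lemma mult_add_right: "mult q a (\<lambda>k. b k + c k) = (\<lambda>k. mult q a b k + mult q a c k)"
  unfolding mult_def down_add q_mult_add_right up_add ..

lemma mult_scale_left: "mult q (\<lambda>k. c * a k) b = (\<lambda>k. c * mult q a b k)"
  unfolding mult_def down_scale q_mult_scale_left up_scale ..

lemma mult_scale_right: "mult q a (\<lambda>k. c * b k) = (\<lambda>k. c * mult q a b k)"
  unfolding mult_def down_scale q_mult_scale_right up_scale ..

lemma mult_one:
  assumes "q \<noteq> 0" "a \<in> S"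
  shows "mult q (x_pow (\<lambda>i. 0)) a = a" "mult q a (x_pow (\<lambda>i. 0)) = a"
proof -
  have "down q a k = 0" if "k \<notin> multi_indices n" for k
    using space_support[OF assms(2) that] by (simp add: down_def)
  then show "mult q (x_pow (\<lambda>i. 0)) a = a" "mult q a (x_pow (\<lambda>i. 0)) = a"
    unfolding mult_def down_one[OF assms(1)]
    using assms by (simp_all add: q_mult_one_left q_mult_one_right up_down space_support)
qed

lemma one_in_space: "x_pow (\<lambda>i. 0) \<in> S"
proof -
  have "(\<lambda>k. cmod (x_pow (\<lambda>i. 0) k) * 1 * \<rho> ^ mi_deg n k) summable_on multi_indices n" for \<rho> :: real
    by (rule finite_nonzero_values_imp_summable_on, rule finite_subset[of _ "{\<lambda>i. 0}"])
      (auto simp: x_pow_def)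
  then show ?thesis by (auto simp: series_space_def x_pow_def)
qed

text \<open>The uniform structure is a parameter because it is an equivalence class for a relation
  that takes the bundle record as an argument; it is supplied at the end.\<close>

definition rescaled_bundle ::
    "((complex \<times> series) \<Rightarrow> real) set set \<Rightarrow> (complex \<times> series, complex) bundle_data" where
  "rescaled_bundle U = \<lparr>total = prod_topology X (series_topology n (\<lambda>_. 1) r), proj = fst,
     badd = (\<lambda>u v. (fst u, \<lambda>k. snd u k + snd v k)), bzero = (\<lambda>q. (q, \<lambda>k. 0)),
     bscale = (\<lambda>c u. (fst u, \<lambda>k. c * snd u k)), bmult = (\<lambda>u v. (fst u, mult (fst u) (snd u) (snd v))),
     bone = (\<lambda>q. (q, x_pow (\<lambda>i. 0))), unif = U\<rparr>"

lemma rescaled_bundle_simps [simp]: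
  "total (rescaled_bundle U) = prod_topology X (series_topology n (\<lambda>_. 1) r)"
  "proj (rescaled_bundle U) = fst"
  "badd (rescaled_bundle U) = (\<lambda>u v. (fst u, \<lambda>k. snd u k + snd v k))"
  "bzero (rescaled_bundle U) = (\<lambda>q. (q, \<lambda>k. 0))"
  "bscale (rescaled_bundle U) = (\<lambda>c u. (fst u, \<lambda>k. c * snd u k))"
  "bmult (rescaled_bundle U) = (\<lambda>u v. (fst u, mult (fst u) (snd u) (snd v)))"
  "bone (rescaled_bundle U) = (\<lambda>q. (q, x_pow (\<lambda>i. 0)))"
  "unif (rescaled_bundle U) = U"
  by (simp_all add: rescaled_bundle_def)

lemma fiber_set_rescaled: "q \<noteq> 0 \<Longrightarrow> fiber_set (rescaled_bundle U) q = {q} \<times> S"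
  by (auto simp: fiber_set_def)

section \<open>Algebra structure of the fibers\<close>

lemma abelian_group_fiber:
  assumes "q \<noteq> 0"
  shows "abelian_group (fiber (rescaled_bundle U) q)"
proof (rule abelian_groupI)
  fix u assume "u \<in> carrier (fiber (rescaled_bundle U) q)"
  then have "u \<in> {q} \<times> S" by (simp add: fiber_set_rescaled[OF assms])
  then show "\<exists>v\<in>carrier (fiber (rescaled_bundle U) q).
      v \<oplus>\<^bsub>fiber (rescaled_bundle U) q\<^esub> u = \<zero>\<^bsub>fiber (rescaled_bundle U) q\<^esub>"
    using space_scale[of "snd u" "-1"]
    by (intro bexI[of _ "(q, \<lambda>k. - snd u k)"]) (auto simp: fiber_set_rescaled[OF assms])
qed (auto simp: fiber_set_rescaled[OF assms] space_add add_ac)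

lemma fiber_minus:
  assumes "q \<noteq> 0" "u \<in> {q} \<times> S" "v \<in> {q} \<times> S"
  shows "u \<ominus>\<^bsub>fiber (rescaled_bundle U) q\<^esub> v = (q, \<lambda>k. snd u k - snd v k)"
proof -
  interpret abelian_group "fiber (rescaled_bundle U) q" by (rule abelian_group_fiber[OF assms(1)])
  have "\<ominus>\<^bsub>fiber (rescaled_bundle U) q\<^esub> v = (q, \<lambda>k. - snd v k)"
    using assms space_scale[of "snd v" "-1"]
    by (intro minus_equality) (auto simp: fiber_set_rescaled)
  with assms show ?thesis by (auto simp: minus_eq)
qed

lemma module_fiber:
  assumes "q \<noteq> 0"
  shows "Module.module C_ring (fiber (rescaled_bundle U) q)"
  by (rule moduleI[OF cring_C_ring abelian_group_fiber[OF assms]])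
    (auto simp: fiber_set_rescaled[OF assms] space_scale algebra_simps)

lemma ring_fiber:
  assumes "q \<noteq> 0"
  shows "Ring.ring (fiber (rescaled_bundle U) q)"
proof (rule ringI[OF abelian_group_fiber[OF assms]])
  show "Group.monoid (fiber (rescaled_bundle U) q)"
    by (rule monoidI)
      (auto simp: fiber_set_rescaled[OF assms] one_in_space mult_closed[OF assms] mult_assoc[OF assms] mult_one[OF assms])
qed (auto simp: fiber_set_rescaled[OF assms] mult_add_left mult_add_right)

lemma complex_algebra_fiber:
  assumes "q \<noteq> 0"
  shows "complex_algebra (fiber (rescaled_bundle U) q)"
  unfolding complex_algebra_def
  using module_fiber[OF assms] ring_fiber[OF assms]
  by (auto simp: fiber_set_rescaled[OF assms] mult_scale_left mult_scale_right)

section \<open>Continuity of the bundle operations\<close>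

lemma openin_X: "openin X V \<longleftrightarrow> open V \<and> 0 \<notin> V"
  using openin_open_eq[of "UNIV - {0 :: complex}" V] by (auto simp: open_Diff)

lemma openin_total_ball:
  assumes "openin X V" "a \<in> S" "radius \<rho>"
  shows "openin (total (rescaled_bundle U)) (V \<times> sball a \<rho> \<epsilon>)"
  unfolding rescaled_bundle_simps openin_prod_Times_iff
  using assms(1) openin_sball[OF assms(2,3)] by (intro disjI2 conjI)

lemma openin_total_imp_ball:
  assumes "openin (total (rescaled_bundle U)) W" "(q, a) \<in> W"
  obtains V \<rho> \<epsilon> where "openin X V" "q \<in> V" "radius \<rho>" "0 < \<epsilon>" "V \<times> sball a \<rho> \<epsilon> \<subseteq> W" "a \<in> S"
proof -
  from assms(1)[unfolded rescaled_bundle_simps openin_prod_topology_alt, rule_format, OF assms(2)]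
  obtain V B where V: "openin X V" "openin (series_topology n (\<lambda>_. 1) r) B" "q \<in> V" "a \<in> B" "V \<times> B \<subseteq> W"
    by (elim exE conjE)
  from V(2,4) obtain \<rho> \<epsilon> where ball: "radius \<rho>" "0 < \<epsilon>" "sball a \<rho> \<epsilon> \<subseteq> B" "a \<in> S"
    unfolding openin_series_topology_iff by blast
  have "V \<times> sball a \<rho> \<epsilon> \<subseteq> W" by (rule order_trans[OF Sigma_mono[OF order_refl ball(3)] V(5)])
  from that[OF V(1,3) ball(1,2) this ball(4)] show thesis .
qed

lemma topspace_fiber_product:
  "topspace (fiber_product (rescaled_bundle U)) =
     {((q, a), (p, b)) | q p a b. q \<noteq> 0 \<and> p = q \<and> a \<in> S \<and> b \<in> S}"
  by (auto simp: fiber_product_def)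

lemma openin_fiber_product_ball:
  assumes "openin X V" "a \<in> S" "b \<in> S" "radius \<rho>"
  shows "openin (fiber_product (rescaled_bundle U))
     ({(u, v). fst u = fst v} \<inter> (V \<times> sball a \<rho> \<delta>) \<times> (V \<times> sball b \<rho> \<delta>))"
proof -
  have "openin (prod_topology (total (rescaled_bundle U)) (total (rescaled_bundle U)))
     ((V \<times> sball a \<rho> \<delta>) \<times> (V \<times> sball b \<rho> \<delta>))"
    unfolding openin_prod_Times_iff[of "total (rescaled_bundle U)"]
    by (intro disjI2 conjI openin_total_ball assms)
  then have "openin (fiber_product (rescaled_bundle U))
     ({(u, v). proj (rescaled_bundle U) u = proj (rescaled_bundle U) v} \<inter> (V \<times> sball a \<rho> \<delta>) \<times> (V \<times> sball b \<rho> \<delta>))"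
    unfolding fiber_product_def by (rule openin_subtopology_Int2)
  then show ?thesis by simp
qed

lemma continuous_map_fiber_product_fst:
  "continuous_map (fiber_product (rescaled_bundle U)) X (\<lambda>x. fst (fst x))"
proof -
  have "continuous_map (prod_topology (total (rescaled_bundle U)) (total (rescaled_bundle U))) X (fst \<circ> fst)"
    by (rule continuous_map_compose[OF continuous_map_fst]) (simp add: continuous_map_fst)
  then show ?thesis
    unfolding fiber_product_def o_def by (rule continuous_map_from_subtopology)
qed

lemma continuous_badd:
  "continuous_map (fiber_product (rescaled_bundle U)) (total (rescaled_bundle U))
     (\<lambda>(u, v). badd (rescaled_bundle U) u v)"
proof -
  have "continuous_map (fiber_product (rescaled_bundle U)) (series_topology n (\<lambda>_. 1) r)
      (\<lambda>x k. snd (fst x) k + snd (snd x) k)"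
    unfolding continuous_map_into_series
  proof (intro conjI ballI allI impI)
    show "(\<lambda>x k. snd (fst x) k + snd (snd x) k) \<in> topspace (fiber_product (rescaled_bundle U)) \<rightarrow> S"
      by (auto simp: topspace_fiber_product intro: space_add)
    fix y \<rho> \<epsilon> assume "y \<in> topspace (fiber_product (rescaled_bundle U))" and \<rho>: "radius \<rho> \<and> (0::real) < \<epsilon>"
    then obtain q a b where y: "y = ((q, a), (q, b))" and q: "q \<noteq> 0" and ab: "a \<in> S" "b \<in> S"
      by (auto simp: topspace_fiber_product)
    let ?W = "{(u, v). fst u = fst v} \<inter> ((UNIV - {0}) \<times> sball a \<rho> (\<epsilon> / 2)) \<times> ((UNIV - {0}) \<times> sball b \<rho> (\<epsilon> / 2))"
    have near: "snorm \<rho> (\<lambda>k. (snd (fst z) k + snd (snd z) k) - (a k + b k)) < \<epsilon>" if zW: "z \<in> ?W" for z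
    proof -
      obtain q' a' q'' b' where z: "z = ((q', a'), (q'', b'))" by (metis prod.collapse)
      with zW have z': "a' \<in> S" "b' \<in> S" "snorm \<rho> (\<lambda>k. a' k - a k) < \<epsilon> / 2" "snorm \<rho> (\<lambda>k. b' k - b k) < \<epsilon> / 2"
        by auto
      have "(\<lambda>k. (a' k + b' k) - (a k + b k)) = (\<lambda>k. (a' k - a k) + (b' k - b k))"
        by (simp add: algebra_simps)
      with snorm_add_le[OF space_diff[OF z'(1) ab(1)] space_diff[OF z'(2) ab(2)], of \<rho>] z' \<rho>
      show ?thesis by (simp add: z)
    qed
    have mem: "y \<in> ?W" unfolding y using q ab \<rho> by simp
    have opn: "openin (fiber_product (rescaled_bundle U)) ?W"
      using \<rho> ab by (intro openin_fiber_product_ball) (auto simp: openin_X open_Diff)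
    show "\<exists>W. openin (fiber_product (rescaled_bundle U)) W \<and> y \<in> W \<and>
        (\<forall>z\<in>W. snorm \<rho> (\<lambda>k. (snd (fst z) k + snd (snd z) k) - (snd (fst y) k + snd (snd y) k)) < \<epsilon>)"
      using opn mem[unfolded y] unfolding y fst_conv snd_conv by (intro exI[of _ ?W] conjI ballI near)
  qed
  from continuous_map_pairedI[OF continuous_map_fiber_product_fst this]
  show ?thesis by (simp add: case_prod_unfold)
qed

lemma continuous_bscale:
  "continuous_map (prod_topology euclidean (total (rescaled_bundle U))) (total (rescaled_bundle U))
     (\<lambda>(c, u). bscale (rescaled_bundle U) c u)"
proof -
  let ?T = "prod_topology euclidean (total (rescaled_bundle U)) :: (complex \<times> complex \<times> series) topology"
  have "continuous_map ?T (series_topology n (\<lambda>_. 1) r) (\<lambda>x k. fst x * snd (snd x) k)"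
    unfolding continuous_map_into_series
  proof (intro conjI ballI allI impI)
    show "(\<lambda>x k. fst x * snd (snd x) k) \<in> topspace ?T \<rightarrow> S"
      by (auto intro: space_scale)
    fix y \<rho> \<epsilon> assume "y \<in> topspace ?T" and \<rho>: "radius \<rho> \<and> (0::real) < \<epsilon>"
    then obtain c q a where y: "y = (c, q, a)" and q: "q \<noteq> 0" and a: "a \<in> S"
      by auto
    \<comment> \<open>The total coefficient of \<open>\<delta>\<close> in the estimate below, where
      \<open>cmod c + 1\<close> bounds the nearby scalar \<open>c'\<close> once
      \<open>\<delta>\<close> is at most 1.\<close>
    define K where "K = cmod c + 1 + snorm \<rho> a"
    have "0 \<le> snorm \<rho> a" using snorm_nonneg \<rho> by blast
    then have K: "0 < K" unfolding K_def using norm_ge_zero[of c] by linarith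
    define \<delta> where "\<delta> = min 1 (\<epsilon> / (2 * K))"
    have \<delta>: "0 < \<delta>" "\<delta> \<le> 1" "\<delta> * K \<le> \<epsilon> / 2"
    proof -
      have "\<delta> * K \<le> \<epsilon> / (2 * K) * K" unfolding \<delta>_def using K by (intro mult_right_mono) auto
      then show "\<delta> * K \<le> \<epsilon> / 2" using K by simp
    qed (use K \<rho> in \<open>simp_all add: \<delta>_def\<close>)
    let ?W = "ball c \<delta> \<times> ((UNIV - {0}) \<times> sball a \<rho> \<delta>)"
    have near: "snorm \<rho> (\<lambda>k. fst z * snd (snd z) k - c * a k) < \<epsilon>" if zW: "z \<in> ?W" for z
    proof -
      obtain c' q' a' where z: "z = (c', q', a')" by (metis prod.collapse)
      with zW have z': "a' \<in> S" "snorm \<rho> (\<lambda>k. a' k - a k) < \<delta>" "cmod (c' - c) < \<delta>"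
        by (auto simp: dist_norm norm_minus_commute)
      have "cmod c' \<le> cmod c + 1"
        using norm_triangle_ineq2[of c' c] z'(3) \<delta>(2) by linarith
      have eq: "(\<lambda>k. c' * a' k - c * a k) = (\<lambda>k. c' * (a' k - a k) + (c' - c) * a k)"
        by (simp add: algebra_simps)
      have "snorm \<rho> (\<lambda>k. c' * a' k - c * a k)
          \<le> cmod c' * snorm \<rho> (\<lambda>k. a' k - a k) + cmod (c' - c) * snorm \<rho> a"
        unfolding eq snorm_scale[symmetric] using \<rho> z' a
        by (intro snorm_add_le space_scale space_diff) auto
      also have "\<dots> \<le> (cmod c + 1) * \<delta> + \<delta> * snorm \<rho> a"
        using \<open>cmod c' \<le> cmod c + 1\<close> z' \<delta>(1) \<rho> snorm_nonneg[of \<rho>] by (intro add_mono mult_mono) auto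
      also have "\<dots> = \<delta> * K" by (simp add: K_def algebra_simps)
      also have "\<dots> < \<epsilon>" using \<delta>(3) \<rho> by linarith
      finally show ?thesis by (simp add: z)
    qed
    have mem: "y \<in> ?W" unfolding y using q a \<delta>(1) by simp
    have opn: "openin ?T ?W"
      using openin_total_ball[of "UNIV - {0}" a \<rho> _ \<delta>] a \<rho>
      by (subst openin_prod_Times_iff) (auto simp: openin_X open_Diff)
    show "\<exists>W. openin ?T W \<and> y \<in> W \<and>
        (\<forall>z\<in>W. snorm \<rho> (\<lambda>k. fst z * snd (snd z) k - fst y * snd (snd y) k) < \<epsilon>)"
      using opn mem[unfolded y] unfolding y fst_conv snd_conv by (intro exI[of _ ?W] conjI ballI near)
  qed
  note series = this
  have "continuous_map ?T X (\<lambda>x. fst (snd x))"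
    using continuous_map_compose[OF continuous_map_snd continuous_map_fst] by (simp add: o_def)
  from continuous_map_pairedI[OF this series] show ?thesis by (simp add: case_prod_unfold)
qed

lemma continuous_bmult:
  "continuous_map (fiber_product (rescaled_bundle U)) (total (rescaled_bundle U))
     (\<lambda>(u, v). bmult (rescaled_bundle U) u v)"
proof -
  have "continuous_map (fiber_product (rescaled_bundle U)) (series_topology n (\<lambda>_. 1) r)
      (\<lambda>x. mult (fst (fst x)) (snd (fst x)) (snd (snd x)))"
    unfolding continuous_map_into_series
  proof (intro conjI ballI allI impI)
    show "(\<lambda>x. mult (fst (fst x)) (snd (fst x)) (snd (snd x))) \<in> topspace (fiber_product (rescaled_bundle U)) \<rightarrow> S"
      by (auto simp: topspace_fiber_product intro: mult_closed)
    fix y \<rho> \<epsilon> assume "y \<in> topspace (fiber_product (rescaled_bundle U))" and \<rho>: "radius \<rho> \<and> (0::real) < \<epsilon>"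
    then obtain q a b where y: "y = ((q, a), (q, b))" and q: "q \<noteq> 0" and ab: "a \<in> S" "b \<in> S"
      by (auto simp: topspace_fiber_product)
    have rad: "radius \<rho>" and nonneg: "0 \<le> snorm \<rho> c" for c using \<rho> snorm_nonneg by auto
    \<comment> \<open>As for scalars: \<open>snorm \<rho> b + 1\<close> bounds the norm of the
      nearby right factor \<open>b'\<close>. The choice of \<open>\<delta>\<close> spends half of
      \<open>\<epsilon>\<close>; the other half is reserved for the defect.\<close>
    define K where "K = snorm \<rho> b + 1 + snorm \<rho> a"
    have K: "0 < K" using nonneg[of a] nonneg[of b] by (simp add: K_def)
    define \<delta> where "\<delta> = min 1 (\<epsilon> / (2 * K))"
    have \<delta>: "0 < \<delta>" "\<delta> \<le> 1" "\<delta> * K \<le> \<epsilon> / 2"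
    proof -
      have "\<delta> * K \<le> \<epsilon> / (2 * K) * K" unfolding \<delta>_def using K by (intro mult_right_mono) auto
      then show "\<delta> * K \<le> \<epsilon> / 2" using K by simp
    qed (use K \<rho> in \<open>simp_all add: \<delta>_def\<close>)
    have "eventually (\<lambda>p. defect \<rho> q a b p < \<epsilon> / 2) (nhds q)"
      by (rule order_tendstoD(2)[OF defect_tendsto_0[OF rad q ab]]) (use \<rho> in simp)
    then obtain V0 where V0: "open V0" "q \<in> V0" "\<And>p. p \<in> V0 \<Longrightarrow> defect \<rho> q a b p < \<epsilon> / 2"
      unfolding eventually_nhds by blast
    define V where "V = V0 - {0}"
    have V: "openin X V" "q \<in> V" using V0 q by (auto simp: V_def openin_X open_Diff)
    let ?W = "{(u, v). fst u = fst v} \<inter> (V \<times> sball a \<rho> \<delta>) \<times> (V \<times> sball b \<rho> \<delta>)"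
    have near: "snorm \<rho> (\<lambda>k. mult (fst (fst z)) (snd (fst z)) (snd (snd z)) k - mult q a b k) < \<epsilon>" if zW: "z \<in> ?W" for z
    proof -
      obtain p a' p' b' where z: "z = ((p, a'), (p', b'))" by (metis prod.collapse)
      with zW have z': "a' \<in> S" "b' \<in> S" "snorm \<rho> (\<lambda>k. a' k - a k) < \<delta>" "snorm \<rho> (\<lambda>k. b' k - b k) < \<delta>"
        "p \<in> V0" "p \<noteq> 0" by (auto simp: V_def)
      have "snorm \<rho> b' \<le> snorm \<rho> (\<lambda>k. b' k - b k) + snorm \<rho> b"
        using snorm_add_le[OF space_diff[OF z'(2) ab(2)] ab(2) rad] by simp
      then have b': "snorm \<rho> b' \<le> snorm \<rho> b + 1" using z'(4) \<delta>(2) by linarith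
      have "snorm \<rho> (\<lambda>k. mult p a' b' k - mult q a b k)
          \<le> snorm \<rho> (\<lambda>k. a' k - a k) * snorm \<rho> b' + snorm \<rho> a * snorm \<rho> (\<lambda>k. b' k - b k) + defect \<rho> q a b p"
        by (rule mult_diff_le[OF rad q z'(6) ab z'(1,2)])
      also have "\<dots> \<le> \<delta> * (snorm \<rho> b + 1) + snorm \<rho> a * \<delta> + defect \<rho> q a b p"
        using b' z' \<delta>(1) nonneg by (intro add_mono mult_mono order_refl) (auto intro: less_imp_le)
      also have "\<dots> = \<delta> * K + defect \<rho> q a b p" by (simp add: K_def algebra_simps)
      also have "\<dots> < \<epsilon>" using \<delta>(3) V0(3)[OF z'(5)] by linarith
      finally show ?thesis by (simp add: z)
    qed
    have mem: "y \<in> ?W" unfolding y using V(2) ab \<delta>(1) by simp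
    have opn: "openin (fiber_product (rescaled_bundle U)) ?W"
      by (rule openin_fiber_product_ball[OF V(1) ab rad])
    show "\<exists>W. openin (fiber_product (rescaled_bundle U)) W \<and> y \<in> W \<and>
        (\<forall>z\<in>W. snorm \<rho> (\<lambda>k. mult (fst (fst z)) (snd (fst z)) (snd (snd z)) k -
          mult (fst (fst y)) (snd (fst y)) (snd (snd y)) k) < \<epsilon>)"
      using opn mem[unfolded y] unfolding y fst_conv snd_conv by (intro exI[of _ ?W] conjI ballI near)
  qed
  from continuous_map_pairedI[OF continuous_map_fiber_product_fst this]
  show ?thesis by (simp add: case_prod_unfold)
qed

lemma prebundle_rescaled: "prebundle X (rescaled_bundle U)"
  unfolding prebundle_def
proof (intro conjI ballI)
  show "locally_compact_space X"
    by (rule locally_compact_space_open_subset) (auto simp: locally_compact_space_euclidean open_Diff)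
  show "Hausdorff_space X" by (simp add: Hausdorff_space_subtopology)
  have "S \<noteq> {}" using space_zero by blast
  then show "proj (rescaled_bundle U) ` topspace (total (rescaled_bundle U)) = topspace X"
    by simp
  show "Module.module C_ring (fiber (rescaled_bundle U) q)" if "q \<in> topspace X" for q
    using that by (intro module_fiber) simp
  show "continuous_map (total (rescaled_bundle U)) X (proj (rescaled_bundle U))"
    by (simp add: continuous_map_fst)
  show "open_map (total (rescaled_bundle U)) X (proj (rescaled_bundle U))"
    by (simp add: open_map_fst)
  have "continuous_map X (prod_topology X (series_topology n (\<lambda>_. 1) r)) (\<lambda>q. (q, \<lambda>k. 0))"
    by (intro continuous_map_pairedI) auto
  then show "continuous_map X (total (rescaled_bundle U)) (bzero (rescaled_bundle U))" by simp
qed (rule continuous_badd continuous_bscale)+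

section \<open>The uniform structure\<close>

definition seminorms :: "((complex \<times> series) \<Rightarrow> real) set" where
  "seminorms = {\<lambda>u. snorm \<rho> (snd u) | \<rho>. radius \<rho>}"

lemma tube_eq: "V \<subseteq> UNIV - {0} \<Longrightarrow> tube (rescaled_bundle U) V (\<lambda>u. snorm \<rho> (snd u)) \<epsilon> = V \<times> sball (\<lambda>k. 0) \<rho> \<epsilon>"
  by (auto simp: tube_def)

text \<open>Every tube is the product of an open set of the base with a ball around 0, and such
  products are a neighborhood base along the zero section. Monotonicity in the radius makes the
  family directed with constant 1.\<close>

lemma admissible_seminorms: "admissible X (rescaled_bundle U) seminorms"
  unfolding admissible_def
proof (intro conjI ballI allI impI)
  have "bundle_seminorm (rescaled_bundle U) (\<lambda>u. snorm \<rho> (snd u))" if "radius \<rho>" for \<rho>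
    unfolding bundle_seminorm_def
  proof (intro conjI ballI allI impI)
    fix u v c
    assume "u \<in> topspace (total (rescaled_bundle U))" "v \<in> topspace (total (rescaled_bundle U))"
    then have "snd u \<in> S" "snd v \<in> S" by auto
    from snorm_add_le[OF this that]
    show "snorm \<rho> (snd (badd (rescaled_bundle U) u v)) \<le> snorm \<rho> (snd u) + snorm \<rho> (snd v)" by simp
  qed (use that snorm_nonneg snorm_scale in simp_all)
  moreover have "\<exists>C>0. \<exists>N\<in>seminorms. seminorm_dominated (rescaled_bundle U) (\<lambda>u. snorm \<rho> (snd u)) N C \<and>
      seminorm_dominated (rescaled_bundle U) (\<lambda>u. snorm \<sigma> (snd u)) N C"
    if \<rho>: "radius \<rho>" and \<sigma>: "radius \<sigma>" for \<rho> \<sigma>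
  proof (intro exI[of _ 1] conjI bexI[of _ "\<lambda>u. snorm (max \<rho> \<sigma>) (snd u)"])
    have m: "radius (max \<rho> \<sigma>)" using \<rho> \<sigma> by (auto simp: max_def)
    then show "(\<lambda>u. snorm (max \<rho> \<sigma>) (snd u)) \<in> seminorms" by (auto simp: seminorms_def)
    show "seminorm_dominated (rescaled_bundle U) (\<lambda>u. snorm \<rho> (snd u)) (\<lambda>u. snorm (max \<rho> \<sigma>) (snd u)) 1"
      "seminorm_dominated (rescaled_bundle U) (\<lambda>u. snorm \<sigma> (snd u)) (\<lambda>u. snorm (max \<rho> \<sigma>) (snd u)) 1"
      unfolding seminorm_dominated_def using snorm_mono[OF _ \<rho> m] snorm_mono[OF _ \<sigma> m] by simp_all
  qed simp
  ultimately show "directed_seminorms (rescaled_bundle U) seminorms"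
    unfolding directed_seminorms_def by (auto simp: seminorms_def)
next
  fix q N \<epsilon> V assume N: "N \<in> seminorms" and \<epsilon>: "(0::real) < \<epsilon>" and V: "openin X V \<and> q \<in> V"
  from N obtain \<rho> where \<rho>: "radius \<rho>" and N: "N = (\<lambda>u. snorm \<rho> (snd u))" by (auto simp: seminorms_def)
  have sub: "V \<subseteq> UNIV - {0}" using V openin_subset by fastforce
  show "openin (total (rescaled_bundle U)) (tube (rescaled_bundle U) V N \<epsilon>)"
    unfolding N tube_eq[OF sub] using V \<rho> by (intro openin_total_ball) auto
  show "bzero (rescaled_bundle U) q \<in> tube (rescaled_bundle U) V N \<epsilon>"
    unfolding N tube_eq[OF sub] using V \<epsilon> by simp
next
  fix q W assume W: "openin (total (rescaled_bundle U)) W \<and> bzero (rescaled_bundle U) q \<in> W"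
  then have "(q, \<lambda>k. 0) \<in> W" by simp
  obtain V \<rho> \<epsilon> where V: "openin X V" "q \<in> V" "radius \<rho>" "0 < \<epsilon>" "V \<times> sball (\<lambda>k. 0) \<rho> \<epsilon> \<subseteq> W"
    by (rule openin_total_imp_ball[OF conjunct1[OF W] \<open>(q, \<lambda>k. 0) \<in> W\<close>])
  have sub: "V \<subseteq> UNIV - {0}" using V openin_subset by fastforce
  show "\<exists>N\<in>seminorms. \<exists>\<epsilon>>0. \<exists>V. openin X V \<and> q \<in> V \<and> tube (rescaled_bundle U) V N \<epsilon> \<subseteq> W"
  proof (intro bexI exI conjI)
    show "tube (rescaled_bundle U) V (\<lambda>u. snorm \<rho> (snd u)) \<epsilon> \<subseteq> W" unfolding tube_eq[OF sub] by (rule V(5))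
    show "(\<lambda>u. snorm \<rho> (snd u)) \<in> seminorms" using V(3) by (auto simp: seminorms_def)
  qed (use V in auto)
qed

section \<open>The fibers are Frechet algebras\<close>

lemma complete_fiber:
  assumes "q \<noteq> 0"
  shows "complete_tvs (fiber (rescaled_bundle U) q)"
  unfolding complete_tvs_def
proof (intro allI impI)
  let ?A = "fiber (rescaled_bundle U) q"
  note fs = fiber_set_rescaled[OF assms]
  fix F assume "F \<noteq> bot \<and> cauchy_filter_in ?A F"
  then have F: "F \<noteq> bot" and cf: "cauchy_filter_in ?A F" by simp_all
  have carr: "eventually (\<lambda>u. u \<in> {q} \<times> S) F"
    using cf unfolding cauchy_filter_in_def fiber_simps fs by (rule conjunct1)
  have cauchy: "\<exists>B\<subseteq>carrier ?A. eventually (\<lambda>x. x \<in> B) F \<and> (\<forall>x\<in>B. \<forall>y\<in>B. x \<ominus>\<^bsub>?A\<^esub> y \<in> W)"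
    if "openin (topol ?A) W" "\<zero>\<^bsub>?A\<^esub> \<in> W" for W
    using cf that unfolding cauchy_filter_in_def by blast
  \<comment> \<open>The base coordinate is constant on the fiber, so the filter may be pushed to the
    model space, where completeness is known.\<close>
  have "\<exists>l\<in>S. \<forall>\<rho> \<epsilon>. radius \<rho> \<and> 0 < \<epsilon> \<longrightarrow> eventually (\<lambda>a. a \<in> sball l \<rho> \<epsilon>) (filtermap snd F)"
  proof (rule series_space_complete)
    show "filtermap snd F \<noteq> bot" using F by (simp add: filtermap_bot_iff)
    fix \<rho> \<epsilon> :: real assume \<rho>: "radius \<rho>" and \<epsilon>: "0 < \<epsilon>"
    let ?W = "{q} \<times> S \<inter> (UNIV - {0}) \<times> sball (\<lambda>k. 0) \<rho> \<epsilon>"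
    have "openin (total (rescaled_bundle U)) ((UNIV - {0}) \<times> sball (\<lambda>k. 0) \<rho> \<epsilon>)"
      using \<rho> by (intro openin_total_ball) (auto simp: openin_X open_Diff)
    then have opn: "openin (topol ?A) ?W"
      unfolding fiber_simps fs by (rule openin_subtopology_Int2)
    have "\<zero>\<^bsub>?A\<^esub> \<in> ?W" using assms \<epsilon> by simp
    from cauchy[OF opn this] obtain B where B0: "B \<subseteq> carrier ?A" and B2: "eventually (\<lambda>x. x \<in> B) F"
      and B3: "\<forall>x\<in>B. \<forall>y\<in>B. x \<ominus>\<^bsub>?A\<^esub> y \<in> ?W"
      by (elim exE conjE)
    have B1: "B \<subseteq> {q} \<times> S" using B0 unfolding fiber_simps fs .
    have "snorm \<rho> (\<lambda>k. snd x k - snd y k) < \<epsilon>" if "x \<in> B" "y \<in> B" for x y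
    proof -
      have xy: "x \<in> {q} \<times> S" "y \<in> {q} \<times> S" using that B1 by auto
      from B3[rule_format, OF that] show ?thesis unfolding fiber_minus[OF assms xy] by simp
    qed
    moreover have "eventually (\<lambda>a. a \<in> snd ` B) (filtermap snd F)"
      unfolding eventually_filtermap using B2 by eventually_elim (rule imageI)
    moreover have "snd ` B \<subseteq> S" using B1 by auto
    ultimately show "\<exists>A\<subseteq>S. eventually (\<lambda>a. a \<in> A) (filtermap snd F) \<and>
        (\<forall>a\<in>A. \<forall>b\<in>A. snorm \<rho> (\<lambda>k. a k - b k) < \<epsilon>)"
      by (intro exI[of _ "snd ` B"]) blast
  qed
  then obtain l where l: "l \<in> S"
    "\<forall>\<rho> \<epsilon>. radius \<rho> \<and> 0 < \<epsilon> \<longrightarrow> eventually (\<lambda>a. a \<in> sball l \<rho> \<epsilon>) (filtermap snd F)"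
    by (elim bexE)
  have near: "eventually (\<lambda>u. snd u \<in> sball l \<rho> \<epsilon>) F" if "radius \<rho>" "0 < \<epsilon>" for \<rho> \<epsilon>
    using l(2)[rule_format, OF conjI[OF that]] unfolding eventually_filtermap .
  have "limitin (topol ?A) (\<lambda>u. u) (q, l) F"
    unfolding limitin_def
  proof (intro conjI allI impI)
    show "(q, l) \<in> topspace (topol ?A)"
      unfolding fiber_simps fs using l(1) assms by simp
    fix W assume W: "openin (topol ?A) W \<and> (q, l) \<in> W"
    then obtain W' where W': "openin (total (rescaled_bundle U)) W'" "W = W' \<inter> {q} \<times> S"
      unfolding fiber_simps fs openin_subtopology by blast
    with W have "(q, l) \<in> W'" by blast
    obtain V \<rho> \<epsilon> where V: "q \<in> V" "radius \<rho>" "0 < \<epsilon>" "V \<times> sball l \<rho> \<epsilon> \<subseteq> W'"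
      by (rule openin_total_imp_ball[OF W'(1) \<open>(q, l) \<in> W'\<close>])
    from carr near[OF V(2,3)] show "eventually (\<lambda>u. u \<in> W) F"
    proof eventually_elim
      case (elim u)
      then have "u \<in> V \<times> sball l \<rho> \<epsilon>" using V(1) by (cases u) auto
      with elim(1) V(4) W'(2) show ?case by blast
    qed
  qed
  then show "\<exists>l. limitin (topol ?A) (\<lambda>u. u) l F" by blast
qed

lemma locally_convex_fiber:
  assumes "q \<noteq> 0"
  shows "locally_convex_space (fiber (rescaled_bundle U) q)"
  unfolding locally_convex_space_def topological_vector_space_def
proof (intro conjI allI impI)
  let ?A = "fiber (rescaled_bundle U) q"
  note fs = fiber_set_rescaled[OF assms]
  show "Module.module C_ring ?A" by (rule module_fiber[OF assms])
  show "topspace (topol ?A) = carrier ?A" unfolding fiber_simps topspace_fiber ..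
  have "badd (rescaled_bundle U) u v \<in> fiber_set (rescaled_bundle U) q"
    if "u \<in> fiber_set (rescaled_bundle U) q" "v \<in> fiber_set (rescaled_bundle U) q" for u v
    using that space_add by (auto simp: fs)
  from continuous_map_fiber_binary[OF continuous_badd this]
  show "continuous_map (prod_topology (topol ?A) (topol ?A)) (topol ?A) (\<lambda>(x, y). x \<oplus>\<^bsub>?A\<^esub> y)"
    by (simp only: fiber_simps)
  have "bscale (rescaled_bundle U) c u \<in> fiber_set (rescaled_bundle U) q"
    if "u \<in> fiber_set (rescaled_bundle U) q" for c u
    using that space_scale by (auto simp: fs)
  from continuous_map_fiber_scale[OF continuous_bscale this]
  show "continuous_map (prod_topology euclidean (topol ?A)) (topol ?A) (\<lambda>(c, x). c \<odot>\<^bsub>?A\<^esub> x)"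
    by (simp only: fiber_simps)
  fix W assume W: "openin (topol ?A) W \<and> \<zero>\<^bsub>?A\<^esub> \<in> W"
  then obtain W' where W': "openin (total (rescaled_bundle U)) W'" "W = W' \<inter> {q} \<times> S"
    unfolding fiber_simps fs openin_subtopology by blast
  have "(q, \<lambda>k. 0) \<in> W'" using W unfolding W'(2) by simp
  obtain V \<rho> \<epsilon> where
    V: "openin X V" "q \<in> V" "radius \<rho>" "0 < \<epsilon>" "V \<times> sball (\<lambda>k. 0) \<rho> \<epsilon> \<subseteq> W'"
    by (rule openin_total_imp_ball[OF W'(1) \<open>(q, \<lambda>k. 0) \<in> W'\<close>])
  \<comment> \<open>Intersecting with the fiber shrinks \<open>V\<close> to \<open>q\<close>; what
    remains of the box is a ball, which is both open in the fiber and convex.\<close>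
  have eq: "{q} \<times> S \<inter> V \<times> sball (\<lambda>k. 0) \<rho> \<epsilon> = {q} \<times> sball (\<lambda>k. 0) \<rho> \<epsilon>" using V(2) by auto
  have opn: "openin (topol ?A) ({q} \<times> sball (\<lambda>k. 0) \<rho> \<epsilon>)"
    unfolding fiber_simps fs eq[symmetric]
    by (rule openin_subtopology_Int2[OF openin_total_ball[OF V(1) space_zero V(3)]])
  have cvx: "convex_in ?A ({q} \<times> sball (\<lambda>k. 0) \<rho> \<epsilon>)"
    unfolding convex_in_def
  proof (intro conjI ballI)
    show "{q} \<times> sball (\<lambda>k. 0) \<rho> \<epsilon> \<subseteq> carrier ?A" unfolding fiber_simps fs by auto
    fix u v and t :: real
    assume "u \<in> {q} \<times> sball (\<lambda>k. 0) \<rho> \<epsilon>" "v \<in> {q} \<times> sball (\<lambda>k. 0) \<rho> \<epsilon>" and t: "t \<in> {0..1}"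
    then obtain a b where uv: "u = (q, a)" "v = (q, b)" and ab: "a \<in> S" "b \<in> S" "snorm \<rho> a < \<epsilon>" "snorm \<rho> b < \<epsilon>"
      by auto
    let ?c = "\<lambda>k. complex_of_real (1 - t) * a k + complex_of_real t * b k"
    have "snorm \<rho> ?c \<le> snorm \<rho> (\<lambda>k. complex_of_real (1 - t) * a k) + snorm \<rho> (\<lambda>k. complex_of_real t * b k)"
      using ab V(3) by (intro snorm_add_le space_scale) auto
    also have "\<dots> = (1 - t) * snorm \<rho> a + t * snorm \<rho> b"
      unfolding snorm_scale norm_of_real using t by simp
    also have "\<dots> < \<epsilon>" using t ab(3,4) by (intro convex_bound_lt) auto
    finally have "snorm \<rho> ?c < \<epsilon>" .
    moreover have "?c \<in> S" using ab by (intro space_add space_scale)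
    ultimately show "complex_of_real (1 - t) \<odot>\<^bsub>?A\<^esub> u \<oplus>\<^bsub>?A\<^esub> complex_of_real t \<odot>\<^bsub>?A\<^esub> v \<in> {q} \<times> sball (\<lambda>k. 0) \<rho> \<epsilon>"
      by (simp add: uv)
  qed
  have zero: "\<zero>\<^bsub>?A\<^esub> \<in> {q} \<times> sball (\<lambda>k. 0) \<rho> \<epsilon>" using V(4) by simp
  have sub: "{q} \<times> sball (\<lambda>k. 0) \<rho> \<epsilon> \<subseteq> W"
    unfolding W'(2) eq[symmetric] using V(5) by (rule Int_greatest[OF order_trans[OF Int_lower2] Int_lower1])
  show "\<exists>V. openin (topol ?A) V \<and> convex_in ?A V \<and> \<zero>\<^bsub>?A\<^esub> \<in> V \<and> V \<subseteq> W"
    by (intro exI[of _ "{q} \<times> sball (\<lambda>k. 0) \<rho> \<epsilon>"] conjI opn cvx zero sub)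
qed

lemma frechet_fiber:
  assumes "q \<noteq> 0"
  shows "frechet_algebra (fiber (rescaled_bundle U) q)"
  unfolding frechet_algebra_def locally_convex_algebra_def
proof (intro conjI)
  let ?A = "fiber (rescaled_bundle U) q"
  have "bmult (rescaled_bundle U) u v \<in> fiber_set (rescaled_bundle U) q"
    if "u \<in> fiber_set (rescaled_bundle U) q" "v \<in> fiber_set (rescaled_bundle U) q" for u v
    using that mult_closed[OF assms] by (auto simp: fiber_set_rescaled[OF assms])
  from continuous_map_fiber_binary[OF continuous_bmult this]
  show "continuous_map (prod_topology (topol ?A) (topol ?A)) (topol ?A) (\<lambda>(x, y). x \<otimes>\<^bsub>?A\<^esub> y)"
    by (simp only: fiber_simps)
  show "metrizable_space (topol ?A)"
    unfolding fiber_simps rescaled_bundle_simps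
    by (intro metrizable_space_subtopology metrizable_space_prod_topology[THEN iffD2] disjI2 conjI
        metrizable_space_euclidean metrizable_series_topology)
qed (rule locally_convex_fiber[OF assms] complex_algebra_fiber[OF assms] complete_fiber[OF assms])+

text \<open>Division by the weight preserves every term of the norm, so \<open>down q\<close> is
  isometric for all radii simultaneously. Continuity of it and of its inverse both come from this
  single equality, and \<open>down_mult\<close> makes it multiplicative.\<close>

lemma topalg_iso_fiber:
  assumes q: "q \<noteq> 0"
  shows "topalg_iso (fiber (rescaled_bundle U) q) (q_algebra n (w q) r q)"
proof -
  let ?A = "fiber (rescaled_bundle U) q" and ?B = "q_algebra n (w q) r q"
  let ?f = "\<lambda>u. down q (snd u)" and ?g = "\<lambda>a. (q, up q a)"
  note fs = fiber_set_rescaled[OF q]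
  interpret target: series_weight n "w q" r
    by unfold_locales (simp_all add: family_pos[OF q] family_radius_pos)
  have norm_down: "cmod (down q a k) * w q k = cmod (a k) * 1" if "k \<in> multi_indices n" for a k
    using family_pos[OF q that] by (simp add: down_def norm_divide)
  have down_S: "down q a \<in> target.S" if "a \<in> S" for a
  proof -
    have "(\<lambda>k. cmod (down q a k) * w q k * \<rho> ^ mi_deg n k) summable_on multi_indices n" if "radius \<rho>" for \<rho>
      using space_summable[OF \<open>a \<in> S\<close> that] by (simp add: norm_down cong: summable_on_cong)
    with that show ?thesis by (simp add: series_space_def down_def)
  qed
  have up_S: "up q a \<in> S" if "a \<in> target.S" for a
  proof -
    have a0: "a k = 0" if "k \<notin> multi_indices n" for k using \<open>a \<in> target.S\<close> that by (simp add: series_space_def)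
    have "(\<lambda>k. cmod (up q a k) * 1 * \<rho> ^ mi_deg n k) summable_on multi_indices n" if "radius \<rho>" for \<rho>
    proof -
      have "cmod (up q a k) * 1 = cmod (a k) * w q k" if "k \<in> multi_indices n" for k
        using family_pos[OF q that] by (simp add: up_def norm_mult)
      with target.space_summable[OF \<open>a \<in> target.S\<close> that] show ?thesis by (simp cong: summable_on_cong)
    qed
    with a0 show ?thesis by (simp add: series_space_def up_def)
  qed
  have norm_eq: "target.snorm \<rho> (\<lambda>k. down q a k - down q b k) = snorm \<rho> (\<lambda>k. a k - b k)" for \<rho> a b
  proof -
    have "(\<lambda>k. down q a k - down q b k) = down q (\<lambda>k. a k - b k)"
      by (simp add: down_def diff_divide_distrib)
    then show ?thesis by (simp add: series_norm_def norm_down cong: infsum_cong)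
  qed
  have fg: "down q (up q a) = a" if "a \<in> target.S" for a
    using that by (intro down_up[OF q]) (simp add: series_space_def)
  have cont_snd: "continuous_map (topol ?A) (series_topology n (\<lambda>_. 1) r) snd"
    unfolding fiber_simps rescaled_bundle_simps
    by (intro continuous_map_from_subtopology continuous_map_snd)
  have "homeomorphic_maps (topol ?A) (series_topology n (w q) r) ?f ?g"
    unfolding homeomorphic_maps_def
  proof (intro conjI ballI)
    show "continuous_map (topol ?A) (series_topology n (w q) r) ?f"
      unfolding target.continuous_map_into_series norm_eq
      using cont_snd[unfolded continuous_map_into_series] down_S by blast
    have "continuous_map (series_topology n (w q) r) (series_topology n (\<lambda>_. 1) r) (up q)"
      unfolding continuous_map_into_series
    proof (intro conjI ballI allI impI)
      show "up q \<in> topspace (series_topology n (w q) r) \<rightarrow> S" using up_S by simp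
      fix a \<rho> \<epsilon> assume a: "a \<in> topspace (series_topology n (w q) r)" and \<rho>: "radius \<rho> \<and> (0::real) < \<epsilon>"
      then have aS: "a \<in> target.S" by simp
      show "\<exists>W. openin (series_topology n (w q) r) W \<and> a \<in> W \<and> (\<forall>z\<in>W. snorm \<rho> (\<lambda>k. up q z k - up q a k) < \<epsilon>)"
      proof (intro exI conjI ballI)
        show "openin (series_topology n (w q) r) (target.sball a \<rho> \<epsilon>)"
          using aS \<rho> by (intro target.openin_sball) auto
        show "a \<in> target.sball a \<rho> \<epsilon>" using aS \<rho> by simp
        fix z assume z: "z \<in> target.sball a \<rho> \<epsilon>"
        then show "snorm \<rho> (\<lambda>k. up q z k - up q a k) < \<epsilon>"
          using norm_eq[of \<rho> "up q z" "up q a"] by (simp add: fg aS)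
      qed
    qed
    then have "continuous_map (series_topology n (w q) r) (prod_topology X (series_topology n (\<lambda>_. 1) r)) ?g"
      using q by (intro continuous_map_pairedI) auto
    then show "continuous_map (series_topology n (w q) r) (topol ?A) ?g"
      unfolding fiber_simps fs rescaled_bundle_simps
      using up_S by (intro continuous_map_into_subtopology) auto
    show "?g (?f u) = u" if "u \<in> topspace (topol ?A)" for u
    proof -
      have "u \<in> {q} \<times> S" using that unfolding fiber_simps fs topspace_subtopology by (rule IntD2)
      then show ?thesis using up_down[OF q space_support] by (cases u) auto
    qed
    show "?f (?g a) = a" if "a \<in> topspace (series_topology n (w q) r)" for a
      using fg that by simp
  qed
  then have homeo: "homeomorphic_map (topol ?A) (topol ?B) ?f"
    unfolding homeomorphic_map_maps by (auto simp: q_algebra_def)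
  have hom: "?f \<in> ring_hom ?A ?B"
    using down_S q by (intro ring_hom_memI)
      (auto simp: fs q_algebra_def down_mult down_add down_one)
  have "\<forall>c. \<forall>x\<in>carrier ?A. ?f (c \<odot>\<^bsub>?A\<^esub> x) = c \<odot>\<^bsub>?B\<^esub> ?f x"
    by (simp add: q_algebra_def down_scale)
  with homeo hom show ?thesis unfolding topalg_iso_def by blast
qed

lemma frechet_algebra_bundle_exists:
  "\<exists>E :: (complex \<times> series, complex) bundle_data. frechet_algebra_bundle X E \<and>
     (\<forall>q\<in>UNIV - {0}. topalg_iso (fiber E q) (q_algebra n (w q) r q))"
proof -
  \<comment> \<open>The apparent circularity is broken with a dummy structure: neither admissibility
    nor domination reads the field \<open>unif\<close>, so the class formed for
    \<open>rescaled_bundle {}\<close> is also one for the bundle that carries it.\<close>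
  define \<U> where "\<U> = seminorms_equiv X (rescaled_bundle {}) `` {seminorms}"
  have adm: "admissible X (rescaled_bundle U) = admissible X (rescaled_bundle {})" for U
    by (simp add: fun_eq_iff admissible_def directed_seminorms_def bundle_seminorm_def seminorm_dominated_def tube_def)
  have prec: "seminorms_prec (rescaled_bundle U) = seminorms_prec (rescaled_bundle {})" for U
    by (simp add: fun_eq_iff seminorms_prec_def seminorm_dominated_def)
  have equiv: "seminorms_equiv X (rescaled_bundle U) = seminorms_equiv X (rescaled_bundle {})" for U
    unfolding seminorms_equiv_def adm[of U] prec[of U] ..
  have "\<U> \<in> {\<N>. admissible X (rescaled_bundle \<U>) \<N>} // seminorms_equiv X (rescaled_bundle \<U>)"
    unfolding equiv[of \<U>] unfolding \<U>_def by (rule quotientI) (simp add: admissible_seminorms)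
  then have "frechet_algebra_bundle X (rescaled_bundle \<U>)"
    unfolding frechet_algebra_bundle_def locally_convex_algebra_bundle_def locally_convex_bundle_def
    using prebundle_rescaled complex_algebra_fiber continuous_bmult frechet_fiber by simp
  then show ?thesis using topalg_iso_fiber by blast
qed

end

lemma weight_family_w_weight:
  assumes "0 < r"
  shows "weight_family n r (w_weight n)"
proof
  show "0 < w_weight n q k" if "q \<noteq> 0" for q k
    using that by (simp add: w_weight_def)
  show "w_weight n q (\<lambda>i. 0) = 1" for q
    by (simp add: w_weight_def)
qed (rule assms continuous_on_w_weight w_weight_submultiplicative, assumption?)+

lemma weight_family_ball_weight:
  assumes "0 < r"
  shows "weight_family n r (ball_weight n)"
proof
  show "ball_weight n q (\<lambda>i. 0) = 1" for q
    by (simp add: ball_weight_def mi_q_fact_def mi_deg_def)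
qed (rule assms ball_weight_pos continuous_on_ball_weight ball_weight_submultiplicative, assumption?)+

theorem theorem7p3:
  fixes n :: nat and r :: ereal
  assumes "1 \<le> n" and "0 < r"
  shows "(\<exists>D :: (complex \<times> series, complex) bundle_data.
            frechet_algebra_bundle (top_of_set (UNIV - {0})) D \<and>
            (\<forall>q\<in>UNIV - {0}. topalg_iso (fiber D q) (q_polydisk n r q))) \<and>
         (\<exists>B :: (complex \<times> series, complex) bundle_data.
            frechet_algebra_bundle (top_of_set (UNIV - {0})) B \<and>
            (\<forall>q\<in>UNIV - {0}. topalg_iso (fiber B q) (q_ball n r q)))"
  unfolding q_polydisk_def q_ball_def
  using weight_family.frechet_algebra_bundle_exists[OF weight_family_w_weight[OF assms(2)]]
    weight_family.frechet_algebra_bundle_exists[OF weight_family_ball_weight[OF assms(2)]]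
  by (rule conjI)

end
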